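(* Let $p$ and $r$ be distinct primes with $p\equiv1\pmod4$ and $\gcd(4,r)=1$. Let $t\ge1$, $m=4t$, $q=p^m$, $c=\frac{q-1}{4}$ and $k=\frac4r\Psi_r(q)$, and assume $q\equiv1\pmod r$. Let $a,b$ be integers with $\sqrt q=a^2+4b^2$, $a\equiv1\pmod4$ and $\gcd(a,p)=1$. For non-negative integers $\ell_1,\dots,\ell_4$ with $h=\ell_1+\ell_2+\ell_3+\ell_4\le r$ put $$w_{\ell_1,\ell_2,\ell_3,\ell_4}=\tfrac{p-1}{4p}\Big(hq+(\ell_1+\ell_2-\ell_3-\ell_4)\sqrt q+\big(2a(\ell_1-\ell_2)+4b(\ell_3-\ell_4)\big)p^t\Big),\qquad A_{\ell_1,\ell_2,\ell_3,\ell_4}=\binom rh\binom{h}{\ell_1,\ell_2,\ell_3,\ell_4}c^h.$$ Then the weights of $\mathcal{C}(k,q^r)$ are the numbers $w_{\ell_1,\ell_2,\ell_3,\ell_4}$, with frequencies $A_{\ell_1,\ell_2,\ell_3,\ell_4}$ (frequencies of tuples giving the same weight being added).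
   Context: $\Psi_r(x)=x^{r-1}+\cdots+x+1$. Let $Q=p^M$, $\omega$ a primitive element of $\mathbb{F}_Q$, $k\mid Q-1$, $n=\frac{Q-1}{k}$. The irreducible cyclic code $\mathcal{C}(k,Q)\subseteq\mathbb{F}_p^n$ consists of the words $c_\gamma=(\mathrm{Tr}_{Q/p}(\gamma\,\omega^{ki}))_{i=0}^{n-1}$, $\gamma\in\mathbb{F}_Q$; the weight of a word is its number of nonzero coordinates, and the frequency of $w$ is $\#\{\gamma\in\mathbb{F}_Q: w(c_\gamma)=w\}$. *)

theory Defs
  imports Complex_Main "HOL-Computational_Algebra.Primes" "HOL-Library.Cardinality" "HOL-Number_Theory.Cong"
begin

definition Psi :: "nat \<Rightarrow> nat \<Rightarrow> nat" where
  "Psi r x = (\<Sum>j<r. x ^ j)"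

text \<open>Absolute trace Tr_{Q/p} of a field with Q = p^M elements, valued in the prime subfield
  (viewed inside the field itself).\<close>
definition abs_trace :: "nat \<Rightarrow> nat \<Rightarrow> 'a::field \<Rightarrow> 'a" where
  "abs_trace p M x = (\<Sum>i<M. x ^ (p ^ i))"

definition primitive_element :: "'a::{field,finite} \<Rightarrow> bool" where
  "primitive_element \<omega> \<longleftrightarrow> (\<forall>x::'a. x \<noteq> 0 \<longrightarrow> (\<exists>i::nat. \<omega> ^ i = x))"

text \<open>Weight of the codeword c_gamma of the irreducible cyclic code C(k,Q), Q = p^M,
  n = (Q-1)/k.\<close>
definition cw_weight :: "nat \<Rightarrow> nat \<Rightarrow> 'a::{field,finite} \<Rightarrow> nat \<Rightarrow> 'a \<Rightarrow> nat" where
  "cw_weight p M \<omega> k \<gamma> =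
     card {i \<in> {0..<(CARD('a) - 1) div k}. abs_trace p M (\<gamma> * \<omega> ^ (k * i)) \<noteq> 0}"

definition frequency :: "nat \<Rightarrow> nat \<Rightarrow> 'a::{field,finite} \<Rightarrow> nat \<Rightarrow> nat \<Rightarrow> nat" where
  "frequency p M \<omega> k w = card {\<gamma>::'a. cw_weight p M \<omega> k \<gamma> = w}"

definition multinomial4 :: "nat \<Rightarrow> nat \<Rightarrow> nat \<Rightarrow> nat \<Rightarrow> nat" where
  "multinomial4 l1 l2 l3 l4 =
     fact (l1 + l2 + l3 + l4) div (fact l1 * fact l2 * fact l3 * fact l4)"

end

theory Submission
  imports Defs "HOL-Number_Theory.Residues" "HOL-Computational_Algebra.Polynomial"
begin

text \<open>
  With \<open>\<alpha> = \<omega>\<^sup>k\<close> one has \<open>\<alpha>\<^sup>q = \<zeta>\<alpha>\<close> for an \<open>r\<close>-th root of unity \<open>\<zeta> \<in> F\<^sub>q\<close>, so by Fourier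
  inversion \<open>\<gamma>\<close> corresponds bijectively to the vector of the relative traces of \<open>\<gamma>\<alpha>\<^sup>s\<close>, \<open>s < r\<close>,
  in \<open>F\<^sub>q\<close>. As \<open>\<alpha>\<^sup>r\<close> generates the fourth powers of \<open>F\<^sub>q\<close>, the weight is the sum over these
  coordinates of the weights of \<open>C(4,q)\<close>, and the frequencies are multinomial counts.

  A weight of \<open>C(4,q)\<close> depends only on the coset of the fourth powers and is governed by quartic
  character sums over elements of trace zero. Let \<open>K\<close> be the subfield of order \<open>\<surd>q\<close>. Splitting
  the units of \<open>F\<^sub>q\<close> along the relative trace to \<open>K\<close> evaluates the quadratic sum outright and writes
  the quartic one as \<open>-(p\<^sup>t - p\<^sup>t\<^sup>-\<^sup>1) S\<close>, where \<open>S = A + B\<i>\<close> is the sum of the quartic character over the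
  elements of relative trace \<open>1\<close>. Its norm is \<open>\<surd>q\<close>, \<open>A\<close> is odd by counting squares, and \<open>p\<close> does not
  divide \<open>A\<close> since modulo a prime above \<open>p\<close> the sum is a central binomial coefficient. Hence
  \<open>A = \<plusminus>a\<close> and \<open>B = \<plusminus>2b\<close>; the signs only permute the four cosets.
\<close>

section \<open>Arithmetic and counting\<close>

lemma multiplicity_fact_div:
  fixes p n :: nat
  assumes "prime p"
  shows "multiplicity p (fact n :: nat) = n div p + multiplicity p (fact (n div p) :: nat)"
proof (induction n)
  case 0
  then show ?case by simp
next
  case (Suc n)
  have p0: "p > 0" "\<not> is_unit p" using assms by (auto simp: prime_gt_0_nat)
  have pe: "prime_elem p" using assms by simp
  have step: "multiplicity p (fact (Suc m) :: nat) = multiplicity p (Suc m) + multiplicity p (fact m :: nat)" for m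
    unfolding fact_Suc using pe by (subst prime_elem_multiplicity_mult_distrib) auto
  show ?case
  proof (cases "p dvd Suc n")
    case True
    then obtain k where k: "Suc n = p * k" by blast
    have k0: "k > 0" using k by (cases k) auto
    have d1: "Suc n div p = Suc (n div p)"
      using True by (simp add: div_Suc)
    have d2: "Suc n div p = k" using k p0 by simp
    \<comment> \<open>Besides its own factor \<open>p\<close>, the new multiple \<open>p * k\<close>
      contributes what \<open>k\<close> contributes to the factorial of \<open>Suc n div p\<close>:
      Legendre's formula in recursive form.\<close>
    have "multiplicity p (Suc n) = Suc (multiplicity p k)"
      unfolding k using k0 p0 by (simp add: multiplicity_times_same)
    then show ?thesis using step[of n] step[of "n div p"] Suc.IH d1 d2 by simp
  next
    case False
    have "Suc n div p = n div p" using False by (simp add: div_Suc dvd_eq_mod_eq_0)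
    moreover have "multiplicity p (Suc n) = 0" using False by (simp add: not_dvd_imp_multiplicity_0)
    ultimately show ?thesis using step[of n] Suc.IH by simp
  qed
qed

text \<open>All base-\<open>p\<close> digits of \<open>(p ^ n - 1) div 4\<close> equal
  \<open>(p - 1) div 4\<close>, so doubling it causes no carry, as in Kummer's theorem. Here this is
  derived from the recursion for the multiplicity of \<open>p\<close> in factorials.\<close>

lemma not_dvd_central_binomial:
  fixes p n :: nat
  assumes "prime p" and "p mod 4 = 1"
  shows "\<not> p dvd (2 * ((p ^ n - 1) div 4) choose ((p ^ n - 1) div 4))"
proof -
  define e where "e n = (p ^ n - 1) div 4" for n
  define f where "f = p div 4"
  have pf: "p = 4 * f + 1" unfolding f_def using assms(2) by presburger
  have f0: "f > 0" using pf assms(1) by (cases f) auto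
  have mod1: "p ^ n mod 4 = 1" for n
    using power_mod[of p 4 n] assms(2) by simp
  have e4: "p ^ n = 4 * e n + 1" for n
    unfolding e_def using mod1[of n] by presburger
  \<comment> \<open>Passing to \<open>Suc n\<close> appends the digit \<open>f\<close>; since
    \<open>2 * f < p\<close>, division by \<open>p\<close> removes the last digit from
    \<open>e\<close> and from \<open>2 * e\<close> alike.\<close>
  have eS: "e (Suc n) = p * e n + f" for n
  proof -
    have "4 * e (Suc n) + 1 = p * (4 * e n + 1)" using e4[of "Suc n"] e4[of n] by simp
    also have "\<dots> = 4 * (p * e n) + p" by (simp add: algebra_simps)
    also have "4 * X + p = 4 * (X + f) + 1" for X using pf by simp
    finally show ?thesis by simp
  qed
  have d1: "e (Suc n) div p = e n" for n
  proof -
    have "f < p" using pf f0 by simp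
    then show ?thesis using eS[of n] by simp
  qed
  have d2: "2 * e (Suc n) div p = 2 * e n" for n
  proof -
    have "2 * e (Suc n) = p * (2 * e n) + 2 * f" using eS[of n] by simp
    moreover have "2 * f < p" using pf by simp
    ultimately show ?thesis by simp
  qed
  have M: "multiplicity p (fact (2 * e n) :: nat) = 2 * multiplicity p (fact (e n) :: nat)" for n
  proof (induction n)
    case 0
    then show ?case by (simp add: e_def)
  next
    case (Suc n)
    then show ?case
      using multiplicity_fact_div[OF assms(1), of "2 * e (Suc n)"]
        multiplicity_fact_div[OF assms(1), of "e (Suc n)"] d1 d2 by simp
  qed
  have pe: "prime_elem p" using assms by simp
  have "(fact (2 * e n) :: nat) = (2 * e n choose e n) * (fact (e n) * fact (e n))"
    using binomial_fact_lemma[of "e n" "2 * e n"] by (simp add: mult_ac mult_2)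
  then have "multiplicity p (fact (2 * e n) :: nat)
      = multiplicity p (2 * e n choose e n) + 2 * multiplicity p (fact (e n) :: nat)"
    using pe by (simp add: prime_elem_multiplicity_mult_distrib)
  then have "multiplicity p (2 * e n choose e n) = 0" using M[of n] by simp
  then have "\<not> p dvd (2 * e n choose e n)"
    using assms(1) binomial_eq_0_iff[of "2 * e n" "e n"]
    by (subst (asm) multiplicity_eq_zero_iff) auto
  then show ?thesis by (simp add: e_def)
qed

text \<open>The power \<open>P\<close> of \<open>p\<close> divides
  \<open>(a * B - A * b) * (a * B + A * b)\<close>, and for positive \<open>k\<close> the prime
  cannot divide both factors, so \<open>P\<close> divides one of them. A size bound then forces that
  factor to be zero.\<close>

lemma sum_two_squares_prime_power_unique:
  fixes a b A B :: int and p k :: nat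
  assumes "prime p" and "odd p"
    and eq: "a\<^sup>2 + b\<^sup>2 = int p ^ k" "A\<^sup>2 + B\<^sup>2 = int p ^ k"
    and "\<not> int p dvd a" and "\<not> int p dvd A" and "odd a" "even b" "odd A" "even B"
  shows "\<bar>A\<bar> = \<bar>a\<bar>" and "\<bar>B\<bar> = \<bar>b\<bar>"
proof -
  define P where "P = int p ^ k"
  have pp: "prime (int p)" using assms by simp
  have P0: "P > 0" using assms unfolding P_def by (simp add: prime_gt_0_nat)
  have id: "(a * B - A * b) * (a * B + A * b) = P * (a\<^sup>2 - A\<^sup>2)"
  proof -
    have "(a * B - A * b) * (a * B + A * b) = a\<^sup>2 * B\<^sup>2 - A\<^sup>2 * b\<^sup>2"
      by (simp add: algebra_simps power2_eq_square)
    also have "\<dots> = a\<^sup>2 * (P - A\<^sup>2) - A\<^sup>2 * (P - a\<^sup>2)"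
      using eq unfolding P_def by (metis add_diff_cancel_left')
    finally show ?thesis by (simp add: algebra_simps)
  qed
  have key: "a * B - s * (A * b) = 0" if s: "s\<^sup>2 = 1" and d: "P dvd a * B - s * (A * b)" for s :: int
  proof (rule ccontr)
    assume nz: "a * B - s * (A * b) \<noteq> 0"
    \<comment> \<open>The Brahmagupta-Fibonacci identity. A nonzero multiple of \<open>P\<close> in
      the first square already exhausts \<open>P\<^sup>2\<close>, so the second square vanishes,
      although its base is odd.\<close>
    have sq: "(a * B - s * (A * b))\<^sup>2 + (a * A + s * (b * B))\<^sup>2 = P\<^sup>2"
    proof -
      have "(a * B - s * (A * b))\<^sup>2 + (a * A + s * (b * B))\<^sup>2
          = a\<^sup>2 * (A\<^sup>2 + B\<^sup>2) + s\<^sup>2 * b\<^sup>2 * (A\<^sup>2 + B\<^sup>2)"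
        by (simp add: algebra_simps power2_eq_square)
      also have "\<dots> = (a\<^sup>2 + b\<^sup>2) * (A\<^sup>2 + B\<^sup>2)" using s by (simp add: algebra_simps)
      finally show ?thesis using eq unfolding P_def by (simp add: power2_eq_square)
    qed
    have "P \<le> \<bar>a * B - s * (A * b)\<bar>" using d nz P0 dvd_imp_le_int[of "a * B - s * (A * b)" P] by simp
    then have "P\<^sup>2 \<le> (a * B - s * (A * b))\<^sup>2" using P0 by (metis abs_le_square_iff abs_of_pos)
    then have "(a * A + s * (b * B))\<^sup>2 \<le> 0" using sq by linarith
    then have "a * A + s * (b * B) = 0" by simp
    moreover have "odd (a * A + s * (b * B))" using assms by simp
    ultimately show False by simp
  qed
  have ndvd: "\<not> (int p dvd a * B - A * b \<and> int p dvd a * B + A * b)" if "k > 0"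
  proof
    assume "int p dvd a * B - A * b \<and> int p dvd a * B + A * b"
    then have "int p dvd (a * B - A * b) + (a * B + A * b)" using dvd_add by blast
    then have "int p dvd 2 * (a * B)" by (simp add: algebra_simps)
    moreover have "\<not> int p dvd 2"
      using assms(1,2) by (metis int_dvd_int_iff of_nat_numeral primes_dvd_imp_eq two_is_prime_nat dvd_refl)
    ultimately have "int p dvd B" using pp assms by (simp add: prime_dvd_mult_iff)
    then have "int p dvd A\<^sup>2 + B\<^sup>2 - B\<^sup>2"
      using that unfolding eq by (simp add: dvd_power power2_eq_square)
    then have "int p dvd A\<^sup>2" by simp
    then show False using pp assms(6) prime_dvd_power by blast
  qed
  have "P dvd a * B - A * b \<or> P dvd a * B + A * b"
  proof (cases "k = 0")
    case True
    then show ?thesis by (simp add: P_def)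
  next
    case False
    then consider "\<not> int p dvd a * B - A * b" | "\<not> int p dvd a * B + A * b" using ndvd by blast
    moreover have D: "P dvd (a * B - A * b) * (a * B + A * b)" using id by simp
    moreover have "coprime P x" if "\<not> int p dvd x" for x
      using that pp unfolding P_def by (simp add: prime_imp_coprime)
    ultimately show ?thesis
      by (metis coprime_dvd_mult_left_iff coprime_dvd_mult_right_iff)
  qed
  then have "(a * B - A * b) * (a * B + A * b) = 0"
    using key[of 1] key[of "-1"] by auto
  then have "a\<^sup>2 = A\<^sup>2" using id P0 by simp
  moreover from this have "b\<^sup>2 = B\<^sup>2" using eq by linarith
  ultimately show "\<bar>A\<bar> = \<bar>a\<bar>" "\<bar>B\<bar> = \<bar>b\<bar>" by (auto simp: power2_eq_iff)
qed

section \<open>Counting lists by the labels of their entries\<close>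

text \<open>The multinomial count, with the factorials multiplied out so that no division occurs.
  Induction on the length splits off the head: a head labelled \<open>i\<close> leaves a tail for
  which \<open>l i\<close> is one smaller.\<close>

lemma card_lists_label_counts:
  fixes lab :: "'b \<Rightarrow> 'i" and l :: "'i \<Rightarrow> nat"
  assumes "finite Y" and "finite I" and "lab ` Y \<subseteq> I"
  shows "card {xs. set xs \<subseteq> Y \<and> length xs = sum l I \<and>
             (\<forall>i\<in>I. length (filter (\<lambda>x. lab x = i) xs) = l i)} * (\<Prod>i\<in>I. fact (l i))
       = fact (sum l I) * (\<Prod>i\<in>I. card {y\<in>Y. lab y = i} ^ l i)"
proof (induction "sum l I" arbitrary: l)
  case 0
  then have l0: "\<forall>i\<in>I. l i = 0" using assms(2) by simp
  then have "{xs. set xs \<subseteq> Y \<and> length xs = sum l I \<and>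
             (\<forall>i\<in>I. length (filter (\<lambda>x. lab x = i) xs) = l i)} = {[]}" using 0 by auto
  then show ?case using l0 by simp
next
  case (Suc n)
  define B where "B l = {xs. set xs \<subseteq> Y \<and> length xs = sum l I \<and>
             (\<forall>i\<in>I. length (filter (\<lambda>x. lab x = i) xs) = l i)}" for l
  \<comment> \<open>Only labels still to be used can occur at the head; for these the truncated
    \<open>l i - 1\<close> is a true predecessor.\<close>
  define J where "J = {i\<in>I. l i > 0}"
  have fB: "finite (B l)" for l
    unfolding B_def by (rule finite_subset[OF _ finite_lists_length_eq[OF assms(1), of "sum l I"]]) auto
  have sumJ: "sum (l(i := l i - 1)) I = n" if "i \<in> J" for i
  proof -
    have iI: "i \<in> I" "l i > 0" using that by (auto simp: J_def)
    have "sum (l(i := l i - 1)) I = (l i - 1) + sum l (I - {i})"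
      using iI(1) assms(2) by (subst sum.remove[of _ i]) (auto intro!: sum.cong)
    moreover have "sum l I = l i + sum l (I - {i})" using iI(1) assms(2) by (subst sum.remove[of _ i]) auto
    ultimately show ?thesis using iI(2) Suc.hyps(2) by linarith
  qed
  have eq: "B l = (\<Union>i\<in>J. (\<lambda>(x, xs). x # xs) ` ({y\<in>Y. lab y = i} \<times> B (l(i := l i - 1))))"
  proof (intro equalityI subsetI)
    fix ys assume ys: "ys \<in> B l"
    then have "length ys = Suc n" using Suc.hyps(2) by (simp add: B_def)
    then obtain x xs where yx: "ys = x # xs" by (cases ys) auto
    define i where "i = lab x"
    have iI: "i \<in> I" using ys assms(3) unfolding B_def yx i_def by auto
    then have "length (filter (\<lambda>x. lab x = i) ys) = l i" using ys by (auto simp: B_def)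
    then have li: "l i = Suc (length (filter (\<lambda>x. lab x = i) xs))" unfolding yx by (simp add: i_def)
    then have iJ: "i \<in> J" using iI by (simp add: J_def)
    have "length (filter (\<lambda>x. lab x = j) xs) = (l(i := l i - 1)) j" if "j \<in> I" for j
      using ys that li unfolding B_def yx i_def by (auto split: if_splits)
    then have "xs \<in> B (l(i := l i - 1))"
      using ys sumJ[OF iJ] Suc.hyps(2) unfolding B_def yx by auto
    moreover have "x \<in> {y\<in>Y. lab y = i}" using ys unfolding B_def yx i_def by auto
    ultimately show "ys \<in> (\<Union>i\<in>J. (\<lambda>(x, xs). x # xs) ` ({y\<in>Y. lab y = i} \<times> B (l(i := l i - 1))))"
      using iJ yx by auto
  next
    fix ys assume "ys \<in> (\<Union>i\<in>J. (\<lambda>(x, xs). x # xs) ` ({y\<in>Y. lab y = i} \<times> B (l(i := l i - 1))))"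
    then obtain i x xs where h: "i \<in> J" "x \<in> Y" "lab x = i" "xs \<in> B (l(i := l i - 1))" "ys = x # xs"
      by auto
    then show "ys \<in> B l"
      using sumJ[OF h(1)] Suc.hyps(2) unfolding B_def J_def by auto
  qed
  have "card (B l) = (\<Sum>i\<in>J. card {y\<in>Y. lab y = i} * card (B (l(i := l i - 1))))"
    unfolding eq
  proof (subst card_UN_disjoint)
    show "finite J" using assms(2) by (simp add: J_def)
    show "\<forall>i\<in>J. finite ((\<lambda>(x, xs). x # xs) ` ({y\<in>Y. lab y = i} \<times> B (l(i := l i - 1))))"
      using fB assms(1) by auto
    show "(\<Sum>i\<in>J. card ((\<lambda>(x, xs). x # xs) ` ({y\<in>Y. lab y = i} \<times> B (l(i := l i - 1))))) =
      (\<Sum>i\<in>J. card {y\<in>Y. lab y = i} * card (B (l(i := l i - 1))))"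
      by (intro sum.cong refl) (subst card_image, auto simp: inj_on_def card_cartesian_product)
  qed auto
  then have "card (B l) * (\<Prod>i\<in>I. fact (l i))
      = (\<Sum>i\<in>J. card {y\<in>Y. lab y = i} * card (B (l(i := l i - 1))) * (\<Prod>i\<in>I. fact (l i)))"
    by (simp add: sum_distrib_right)
  \<comment> \<open>Lowering \<open>l i\<close> frees one factor \<open>l i\<close> of the
    factorials; summed over \<open>i\<close> these factors give \<open>Suc n\<close>, which
    completes \<open>fact n\<close>.\<close>
  also have "\<dots> = (\<Sum>i\<in>J. l i * (fact n * (\<Prod>i\<in>I. card {y\<in>Y. lab y = i} ^ l i)))"
  proof (intro sum.cong refl)
    fix i assume iJ: "i \<in> J"
    define l' where "l' = l(i := l i - 1)"
    have iI: "i \<in> I" "l i > 0" using iJ by (auto simp: J_def)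
    define m where "m i = card {y\<in>Y. lab y = i}" for i
    have p1: "(\<Prod>i\<in>I. fact (l i)) = l i * (\<Prod>i\<in>I. fact (l' i) :: nat)"
    proof -
      have "(\<Prod>i\<in>I. fact (l i) :: nat) = fact (l i) * (\<Prod>i\<in>I - {i}. fact (l i))"
        using iI(1) assms(2) by (rule prod.remove[rotated])
      also have "(\<Prod>i\<in>I - {i}. fact (l i) :: nat) = (\<Prod>i\<in>I - {i}. fact (l' i))"
        by (intro prod.cong) (auto simp: l'_def)
      also have "fact (l i) = l i * fact (l' i)" using iI(2) by (simp add: l'_def fact_reduce)
      also have "l i * fact (l' i) * (\<Prod>i\<in>I - {i}. fact (l' i)) = l i * (\<Prod>i\<in>I. fact (l' i) :: nat)"
        using iI(1) assms(2) by (subst prod.remove[of I i]) (auto simp: mult_ac)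
      finally show ?thesis .
    qed
    have p2: "(\<Prod>i\<in>I. m i ^ l i) = m i * (\<Prod>i\<in>I. m i ^ l' i)"
    proof -
      have "(\<Prod>i\<in>I. m i ^ l i) = m i ^ l i * (\<Prod>i\<in>I - {i}. m i ^ l i)"
        using iI(1) assms(2) by (rule prod.remove[rotated])
      also have "(\<Prod>i\<in>I - {i}. m i ^ l i) = (\<Prod>i\<in>I - {i}. m i ^ l' i)"
        by (intro prod.cong) (auto simp: l'_def)
      also have "m i ^ l i = m i * m i ^ l' i" using iI(2) by (simp add: l'_def power_eq_if)
      also have "m i * m i ^ l' i * (\<Prod>i\<in>I - {i}. m i ^ l' i) = m i * (\<Prod>i\<in>I. m i ^ l' i)"
        using iI(1) assms(2) by (subst prod.remove[of I i]) (auto simp: mult_ac)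
      finally show ?thesis .
    qed
    have "card (B l') * (\<Prod>i\<in>I. fact (l' i)) = fact n * (\<Prod>i\<in>I. m i ^ l' i)"
      using Suc.hyps(1)[of l'] sumJ[OF iJ] unfolding B_def m_def l'_def by simp
    then show "card {y\<in>Y. lab y = i} * card (B (l(i := l i - 1))) * (\<Prod>i\<in>I. fact (l i))
        = l i * (fact n * (\<Prod>i\<in>I. card {y\<in>Y. lab y = i} ^ l i))"
      using p1 p2 unfolding m_def l'_def by (simp add: mult_ac)
  qed
  also have "\<dots> = (\<Sum>i\<in>J. l i) * (fact n * (\<Prod>i\<in>I. card {y\<in>Y. lab y = i} ^ l i))"
    by (simp add: sum_distrib_right)
  also have "(\<Sum>i\<in>J. l i) = sum l I"
    unfolding J_def using assms(2) by (intro sum.mono_neutral_left) auto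
  also have "sum l I * (fact n * (\<Prod>i\<in>I. card {y\<in>Y. lab y = i} ^ l i))
      = fact (sum l I) * (\<Prod>i\<in>I. card {y\<in>Y. lab y = i} ^ l i)"
    by (simp add: algebra_simps flip: Suc.hyps(2))
  finally show ?case unfolding B_def .
qed

lemma sum_length_filter_label:
  assumes "finite I" "lab ` set xs \<subseteq> I"
  shows "(\<Sum>i\<in>I. length (filter (\<lambda>x. lab x = i) xs)) = length xs"
  using assms(2)
proof (induction xs)
  case (Cons x xs)
  have "(\<Sum>i\<in>I. length (filter (\<lambda>x. lab x = i) (x # xs)))
      = (\<Sum>i\<in>I. (if i = lab x then 1 else 0) + length (filter (\<lambda>x. lab x = i) xs))"
    by (rule sum.cong) auto
  also have "\<dots> = 1 + length xs"
    using Cons assms(1) by (simp add: sum.distrib)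
  finally show ?case by simp
qed simp

text \<open>The \<open>div\<close> in \<open>multinomial4\<close> is exact: when the factorials are
  merged one at a time, each product divides the next.\<close>

lemma multinomial4_fact:
  "multinomial4 l1 l2 l3 l4 * (fact l1 * fact l2 * fact l3 * fact l4) = fact (l1 + l2 + l3 + l4)"
proof -
  have "fact l1 * fact l2 * fact l3 * fact l4 dvd (fact (l1 + l2) * fact l3 * fact l4 :: nat)"
    by (intro mult_dvd_mono fact_fact_dvd_fact dvd_refl)
  also have "\<dots> dvd fact (l1 + l2 + l3) * fact l4"
    by (intro mult_dvd_mono fact_fact_dvd_fact dvd_refl)
  also have "\<dots> dvd fact (l1 + l2 + l3 + l4)" by (rule fact_fact_dvd_fact)
  finally show ?thesis unfolding multinomial4_def by (rule dvd_div_mult_self)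
qed

text \<open>Label 0 is meant for the zero coordinate: with a single member it adds no factor, and
  its multiplicity \<open>r - h\<close> is forced by the length. Hence \<open>fact r\<close> splits
  into \<open>r choose h\<close> and a multinomial coefficient in the other four labels.
  \<open>Q\<close> later becomes the equation for the weight.\<close>

lemma card_lists_four_classes:
  fixes lab :: "'b \<Rightarrow> nat" and Q :: "nat \<Rightarrow> nat \<Rightarrow> nat \<Rightarrow> nat \<Rightarrow> bool"
  assumes Y: "finite Y" "lab ` Y \<subseteq> {0, 1, 2, 3, 4}"
    and card0: "card {y\<in>Y. lab y = 0} = 1"
    and card_c: "\<And>i. i \<in> {1, 2, 3, 4} \<Longrightarrow> card {y\<in>Y. lab y = i} = c"
  defines "n \<equiv> \<lambda>i xs. length (filter (\<lambda>x. lab x = i) xs)"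
  shows "card {xs. set xs \<subseteq> Y \<and> length xs = r \<and> Q (n 1 xs) (n 2 xs) (n 3 xs) (n 4 xs)}
    = (\<Sum>(l1, l2, l3, l4)\<in>{(l1, l2, l3, l4). l1 + l2 + l3 + l4 \<le> r \<and> Q l1 l2 l3 l4}.
        (r choose (l1 + l2 + l3 + l4)) * multinomial4 l1 l2 l3 l4 * c ^ (l1 + l2 + l3 + l4))"
proof -
  let ?D = "{(l1, l2, l3, l4). l1 + l2 + l3 + l4 \<le> r \<and> Q l1 l2 l3 l4}"
  let ?X = "{xs. set xs \<subseteq> Y \<and> length xs = r \<and> Q (n 1 xs) (n 2 xs) (n 3 xs) (n 4 xs)}"
  let ?f = "\<lambda>xs. (n 1 xs, n 2 xs, n 3 xs, n 4 xs)"
  have total: "n 0 xs + n 1 xs + n 2 xs + n 3 xs + n 4 xs = length xs" if "set xs \<subseteq> Y" for xs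
  proof -
    have "lab ` set xs \<subseteq> {0, 1, 2, 3, 4}" by (rule subset_trans[OF image_mono[OF that] Y(2)])
    then have "(\<Sum>i\<in>{0, 1, 2, 3, 4}. n i xs) = length xs"
      unfolding n_def by (intro sum_length_filter_label) auto
    then show ?thesis by (simp add: add.assoc)
  qed
  have finX: "finite ?X"
    by (rule finite_subset[OF _ finite_lists_length_eq[OF Y(1), of r]]) auto
  have finD: "finite ?D"
    by (rule finite_subset[of _ "{..r} \<times> {..r} \<times> {..r} \<times> {..r}"]) auto
  have each: "card {xs\<in>?X. ?f xs = (l1, l2, l3, l4)}
      = (r choose (l1 + l2 + l3 + l4)) * multinomial4 l1 l2 l3 l4 * c ^ (l1 + l2 + l3 + l4)"
    if D: "(l1, l2, l3, l4) \<in> ?D" for l1 l2 l3 l4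
  proof -
    define h where "h = l1 + l2 + l3 + l4"
    have h: "h \<le> r" using D by (simp add: h_def)
    define l where "l = (\<lambda>i::nat. if i = 0 then r - h else if i = 1 then l1 else if i = 2 then l2
      else if i = 3 then l3 else l4)"
    define N where "N = card {xs\<in>?X. ?f xs = (l1, l2, l3, l4)}"
    have sl: "sum l {0, 1, 2, 3, 4} = r" using h by (simp add: l_def h_def)
    have "{xs\<in>?X. ?f xs = (l1, l2, l3, l4)} = {xs. set xs \<subseteq> Y \<and> length xs = sum l {0, 1, 2, 3, 4} \<and>
             (\<forall>i\<in>{0, 1, 2, 3, 4}. length (filter (\<lambda>x. lab x = i) xs) = l i)}"
    proof (intro equalityI subsetI)
      fix xs assume xs: "xs \<in> {xs\<in>?X. ?f xs = (l1, l2, l3, l4)}"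
      then have "n 0 xs = r - h" using total[of xs] by (auto simp: h_def)
      then show "xs \<in> {xs. set xs \<subseteq> Y \<and> length xs = sum l {0, 1, 2, 3, 4} \<and>
             (\<forall>i\<in>{0, 1, 2, 3, 4}. length (filter (\<lambda>x. lab x = i) xs) = l i)}"
        using xs unfolding sl by (simp add: n_def l_def)
    next
      fix xs assume "xs \<in> {xs. set xs \<subseteq> Y \<and> length xs = sum l {0, 1, 2, 3, 4} \<and>
             (\<forall>i\<in>{0, 1, 2, 3, 4}. length (filter (\<lambda>x. lab x = i) xs) = l i)}"
      then show "xs \<in> {xs\<in>?X. ?f xs = (l1, l2, l3, l4)}"
        using D unfolding sl by (simp add: n_def l_def)
    qed
    then have "N * (\<Prod>i\<in>{0, 1, 2, 3, 4}. fact (l i))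
        = fact r * (\<Prod>i\<in>{0, 1, 2, 3, 4}. card {y\<in>Y. lab y = i} ^ l i)"
      using card_lists_label_counts[OF Y(1) _ Y(2), of l] unfolding N_def sl by simp
    then have "N * (fact (r - h) * (fact l1 * fact l2 * fact l3 * fact l4)) = fact r * c ^ h"
      using card0 card_c[of 1] card_c[of 2] card_c[of 3] card_c[of 4]
      by (simp add: l_def h_def power_add mult_ac)
    also have "fact r = (r choose h) * (fact h * fact (r - h))"
      using binomial_fact_lemma[OF h] by (simp add: mult_ac)
    also have "fact h = multinomial4 l1 l2 l3 l4 * (fact l1 * fact l2 * fact l3 * fact l4)"
      unfolding h_def by (rule multinomial4_fact[symmetric])
    finally have "N * (fact (r - h) * (fact l1 * fact l2 * fact l3 * fact l4))
       = ((r choose h) * multinomial4 l1 l2 l3 l4 * c ^ h) * (fact (r - h) * (fact l1 * fact l2 * fact l3 * fact l4))"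
      by (simp only: mult_ac)
    then have "N = (r choose h) * multinomial4 l1 l2 l3 l4 * c ^ h"
      by (subst (asm) mult_right_cancel) simp_all
    then show ?thesis by (simp add: N_def h_def)
  qed
  have im: "?f ` ?X \<subseteq> ?D"
  proof
    fix l assume "l \<in> ?f ` ?X"
    then obtain xs where xs: "xs \<in> ?X" "l = ?f xs" by blast
    then show "l \<in> ?D" using total[of xs] by auto
  qed
  have "card ?X = (\<Sum>l\<in>?D. card {xs\<in>?X. ?f xs = l})"
    using sum.group[OF finX finD im, of "\<lambda>_. 1::nat"] by simp
  also have "\<dots> = (\<Sum>(l1, l2, l3, l4)\<in>?D.
        (r choose (l1 + l2 + l3 + l4)) * multinomial4 l1 l2 l3 l4 * c ^ (l1 + l2 + l3 + l4))"
  proof (rule sum.cong[OF refl])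
    fix l assume l: "l \<in> ?D"
    obtain l1 l2 l3 l4 where e: "l = (l1, l2, l3, l4)" by (rule prod_cases4)
    show "card {xs\<in>?X. ?f xs = l} = (case l of (l1, l2, l3, l4) \<Rightarrow>
        (r choose (l1 + l2 + l3 + l4)) * multinomial4 l1 l2 l3 l4 * c ^ (l1 + l2 + l3 + l4))"
      using each[OF l[unfolded e]] unfolding e by (simp only: prod.case)
  qed
  finally show ?thesis .
qed

lemma Psi_geometric: "Psi r x * (x - 1) + 1 = x ^ r" if "x > 0"
proof (induction r)
  case (Suc r)
  have "Psi (Suc r) x * (x - 1) + 1 = (Psi r x * (x - 1) + 1) + x ^ r * (x - 1)"
    by (simp add: Psi_def algebra_simps)
  also have "\<dots> = x ^ r * (1 + (x - 1))" unfolding Suc.IH by (simp only: distrib_left mult_1_right)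
  finally show ?case using that by (simp add: mult.commute)
qed (simp add: Psi_def)

text \<open>Each of the \<open>r\<close> summands is 1 modulo \<open>r\<close>. This makes the
  division by \<open>r\<close> in the parameter \<open>k\<close> of the code exact.\<close>

lemma dvd_Psi:
  assumes "[x = 1] (mod r)"
  shows "r dvd Psi r x"
proof -
  have "[Psi r x = (\<Sum>j<r. 1 ^ j)] (mod r)"
    unfolding Psi_def by (intro cong_sum cong_pow assms)
  then show ?thesis by (simp add: cong_0_iff[symmetric] cong_def)
qed

section \<open>Subfields and traces of a finite field\<close>

locale primitive_field =
  fixes p M :: nat and \<omega> :: "'a::{field,finite}"
  assumes prime_p: "prime p" and p_mod_4: "p mod 4 = 1"
    and card_field: "CARD('a) = p ^ M" and primitive: "primitive_element \<omega>"
begin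

text \<open>The fixed points of the \<open>n\<close>-fold Frobenius map; for positive
  \<open>n\<close> dividing \<open>M\<close> they form the subfield of order
  \<open>p ^ n\<close>.\<close>

definition F :: "nat \<Rightarrow> 'a set" where
  "F n = {x. x ^ (p ^ n) = x}"

abbreviation U :: "nat \<Rightarrow> 'a set" where
  "U n \<equiv> F n - {0}"

lemma p_gt_1: "p > 1"
  using prime_p by (rule prime_gt_1_nat)

lemma char_p: "CHAR('a) = p"
proof -
  have "prime CHAR('a)" by (intro prime_CHAR_semidom finite_imp_CHAR_pos) simp
  moreover have "CHAR('a) dvd p ^ M" using CHAR_dvd_CARD[where 'a='a] card_field by simp
  ultimately show ?thesis using prime_p by (metis prime_dvd_power primes_dvd_imp_eq)
qed

lemma of_nat_eq_0: "of_nat k = (0::'a) \<longleftrightarrow> p dvd k"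
  using of_nat_eq_0_iff_char_dvd[where 'a='a] char_p by simp

lemma p_pow_mod_4: "p ^ n mod 4 = 1"
  using power_mod[of p 4 n] p_mod_4 by simp

lemma odd_p_pow: "odd (p ^ n)"
  using p_pow_mod_4[of n] by presburger

lemma p_gt_2: "p > 2"
  using p_mod_4 p_gt_1 by (cases "p = 2") auto

lemma two_nz: "(2::'a) \<noteq> 0"
proof -
  have "\<not> p dvd 2" using p_gt_2 by (auto dest!: dvd_imp_le)
  then show ?thesis using of_nat_eq_0[of 2] by simp
qed

lemma frob_add: "(x + y :: 'a) ^ (p ^ n) = x ^ (p ^ n) + y ^ (p ^ n)"
  by (rule freshmans_dream') (auto simp: char_p prime_p)

lemma frob_sum: "(sum f A :: 'a) ^ (p ^ n) = (\<Sum>i\<in>A. f i ^ (p ^ n))"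
  by (rule freshmans_dream_sum') (auto simp: char_p prime_p)

lemma frob_minus: "(- x :: 'a) ^ (p ^ n) = - (x ^ (p ^ n))"
  using odd_p_pow by (rule power_minus_odd)

lemma card_field_gt_2: "p ^ M > 2"
proof -
  have "card {0, 1 :: 'a} \<le> CARD('a)" by (rule card_mono) auto
  then have "M \<noteq> 0" using card_field by (cases M) auto
  then have "p \<le> p ^ M" using p_gt_1 by (simp add: self_le_power)
  then show ?thesis using p_gt_2 by simp
qed

section \<open>The cyclic multiplicative group\<close>

lemma primitive_nz: "\<omega> \<noteq> 0"
proof
  assume w: "\<omega> = 0"
  \<comment> \<open>Powers of 0 are only 0 and 1, and in odd characteristic 2 is neither.\<close>
  have "(2::'a) \<noteq> 1" by (metis add_cancel_right_left one_add_one zero_neq_one)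
  moreover obtain i :: nat where "\<omega> ^ i = 2" using primitive two_nz unfolding primitive_element_def by blast
  ultimately show False using w two_nz by (cases i) auto
qed

lemma power_card_minus_1: "x \<noteq> 0 \<Longrightarrow> x ^ (p ^ M - 1) = (1::'a)"
proof -
  assume x: "x \<noteq> 0"
  have "(\<Prod>y\<in>UNIV - {0::'a}. x * y) = (\<Prod>y\<in>UNIV - {0}. y)"
    by (rule prod.reindex_bij_witness[of _ "\<lambda>y. y / x" "\<lambda>y. x * y"]) (use x in auto)
  then have "x ^ (p ^ M - 1) * (\<Prod>y\<in>UNIV - {0::'a}. y) = (\<Prod>y\<in>UNIV - {0}. y)"
    by (simp add: prod.distrib card_field)
  then show ?thesis by simp
qed

text \<open>The first \<open>p ^ M - 1\<close> powers of \<open>\<omega>\<close> cover as many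
  nonzero elements, so they are pairwise distinct by counting.\<close>

lemma primitive_power_eq_1_iff: "\<omega> ^ i = 1 \<longleftrightarrow> (p ^ M - 1) dvd i"
proof -
  define N where "N = p ^ M - 1"
  have N0: "N > 0" using card_field_gt_2 by (simp add: N_def)
  have w1: "\<omega> ^ N = 1" unfolding N_def by (rule power_card_minus_1[OF primitive_nz])
  have red: "\<omega> ^ i = \<omega> ^ (i mod N)" for i
  proof -
    have "\<omega> ^ i = \<omega> ^ (N * (i div N) + i mod N)" by simp
    also have "\<dots> = (\<omega> ^ N) ^ (i div N) * \<omega> ^ (i mod N)" by (simp only: power_add power_mult)
    finally show ?thesis by (simp add: w1)
  qed
  have im: "(\<lambda>i. \<omega> ^ i) ` {..<N} = UNIV - {0}"
  proof (intro equalityI subsetI)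
    fix x :: 'a assume "x \<in> UNIV - {0}"
    then obtain i :: nat where "\<omega> ^ i = x" using primitive unfolding primitive_element_def by blast
    then show "x \<in> (\<lambda>i. \<omega> ^ i) ` {..<N}" using red[of i] N0 by (intro image_eqI[of _ _ "i mod N"]) auto
  qed (use primitive_nz in auto)
  have "inj_on (\<lambda>i. \<omega> ^ i) {..<N}"
    by (rule eq_card_imp_inj_on) (simp_all only: im finite_lessThan card_lessThan, simp add: card_field N_def)
  then have "\<omega> ^ (i mod N) = \<omega> ^ 0 \<longleftrightarrow> i mod N = 0"
    using N0 by (subst inj_on_eq_iff[of "\<lambda>i. \<omega> ^ i" "{..<N}"]) auto
  then show ?thesis using red[of i] unfolding N_def[symmetric] by (simp add: dvd_eq_mod_eq_0)
qed

text \<open>The witness is \<open>\<omega> ^ m\<close> with \<open>d * m = p ^ M - 1\<close>. Its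
  powers are \<open>d\<close> roots of \<open>monom 1 d - 1\<close>, and the degree allows no
  more.\<close>

lemma exists_root_of_unity_of_order:
  assumes "d dvd p ^ M - 1"
  obtains g :: 'a where "g \<noteq> 0" "\<And>i. g ^ i = 1 \<longleftrightarrow> d dvd i"
    "{x. x ^ d = 1} = (\<lambda>j. g ^ j) ` {..<d}" "inj_on (\<lambda>j. g ^ j) {..<d}"
proof -
  define N where "N = p ^ M - 1"
  have N0: "N > 0" using card_field_gt_2 by (simp add: N_def)
  obtain m where m: "N = d * m" using assms by (auto simp: N_def)
  have d0: "d > 0" "m > 0" using N0 m by auto
  define g where "g = \<omega> ^ m"
  have g0: "g \<noteq> 0" using primitive_nz by (simp add: g_def)
  have ord: "g ^ i = 1 \<longleftrightarrow> d dvd i" for i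
    using primitive_power_eq_1_iff[of "m * i"] d0 unfolding g_def N_def[symmetric] m
    by (simp add: mult.commute[of d] flip: power_mult)
  have inj: "inj_on (\<lambda>j. g ^ j) {..<d}"
  proof (rule linorder_inj_onI)
    fix i j assume ij: "i < j" "i \<in> {..<d}" "j \<in> {..<d}"
    show "g ^ i \<noteq> g ^ j"
    proof
      assume "g ^ i = g ^ j"
      also have "g ^ j = g ^ i * g ^ (j - i)" using ij by (simp flip: power_add)
      finally have "g ^ (j - i) = 1" using g0 by simp
      then have "d dvd j - i" using ord by simp
      then show False using ij by (auto dest!: dvd_imp_le)
    qed
  qed auto
  have "(\<lambda>j. g ^ j) ` {..<d} = {x. x ^ d = 1}"
  proof (rule card_subset_eq)
    have "(g ^ j) ^ d = 1" for j using ord[of "j * d"] by (simp add: power_mult)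
    then show "(\<lambda>j. g ^ j) ` {..<d} \<subseteq> {x. x ^ d = 1}" by auto
    moreover have "card {x::'a. x ^ d = 1} \<le> d"
    proof -
      define f :: "'a poly" where "f = monom 1 d - 1"
      have deg: "degree f \<le> d" unfolding f_def
        by (intro degree_diff_le) (auto simp: degree_monom_le)
      have "coeff f d = 1" unfolding f_def using d0 by simp
      then have "f \<noteq> 0" by auto
      then have "card {x. poly f x = 0} \<le> degree f" by (rule card_poly_roots_bound)
      moreover have "{x. poly f x = 0} = {x. x ^ d = 1}" by (auto simp: f_def poly_monom)
      ultimately show ?thesis using deg by simp
    qed
    moreover have "card ((\<lambda>j. g ^ j) ` {..<d}) = d" using card_image[OF inj] by simp
    ultimately show "card ((\<lambda>j. g ^ j) ` {..<d}) = card {x::'a. x ^ d = 1}"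
      using card_mono[of "{x::'a. x ^ d = 1}" "(\<lambda>j. g ^ j) ` {..<d}"] by simp
  qed simp
  then show ?thesis using that[of g] g0 ord inj by simp
qed

lemma card_roots_of_unity:
  assumes "d dvd p ^ M - 1"
  shows "card {x::'a. x ^ d = 1} = d"
  using exists_root_of_unity_of_order[OF assms] card_image by (metis card_lessThan)

lemma dvd_minus_1:
  assumes "n dvd M"
  shows "(p ^ n - 1) dvd (p ^ M - 1)"
proof -
  obtain k where k: "M = n * k" using assms by blast
  have "[(p ^ n) ^ k = 1 ^ k] (mod (p ^ n - 1))"
    by (rule cong_pow) (use p_gt_1 in \<open>simp add: cong_altdef_nat\<close>)
  then have "[p ^ M = 1] (mod (p ^ n - 1))" by (simp add: k power_mult)
  then show ?thesis using p_gt_1 by (simp add: cong_altdef_nat)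
qed

section \<open>Subfields and sums over their units\<close>

lemma units_eq: "U n = {x. x ^ (p ^ n - 1) = 1}" if "n > 0"
proof -
  have "p ^ n > 1" using p_gt_1 that by (intro one_less_power)
  then have e: "x ^ (p ^ n) = x * x ^ (p ^ n - 1)" for x :: 'a
    using power_Suc[of x "p ^ n - 1"] by (simp only: Suc_diff_1)
  have "p ^ n - 1 > 0" using \<open>p ^ n > 1\<close> by simp
  then show ?thesis unfolding F_def by (auto simp: e power_0_left)
qed

lemma card_units:
  assumes "n dvd M" "n > 0"
  shows "card (U n) = p ^ n - 1"
  using card_roots_of_unity[OF dvd_minus_1[OF assms(1)]] units_eq[OF assms(2)] by simp

lemma F_closed [simp, intro]:
  "0 \<in> F n" "1 \<in> F n" "x \<in> F n \<Longrightarrow> y \<in> F n \<Longrightarrow> x + y \<in> F n"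
  "x \<in> F n \<Longrightarrow> y \<in> F n \<Longrightarrow> x * y \<in> F n" "x \<in> F n \<Longrightarrow> - x \<in> F n"
  "x \<in> F n \<Longrightarrow> inverse x \<in> F n" "x \<in> F n \<Longrightarrow> y \<in> F n \<Longrightarrow> x / y \<in> F n"
  "x \<in> F n \<Longrightarrow> x ^ k \<in> F n"
  unfolding F_def
  using p_gt_1 frob_add[of x y n] frob_minus[of x n]
  by (auto simp: power_mult_distrib power_inverse power_divide power_mult[symmetric] zero_power mult.commute[of k] )
     (simp add: power_mult)

lemma card_F:
  assumes "n dvd M" "n > 0"
  shows "card (F n) = p ^ n"
proof -
  have "card (F n) = Suc (card (U n))"
    by (subst card_Suc_Diff1) auto
  then show ?thesis using card_units[OF assms] p_gt_1 by simp
qed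

lemma F_mono: "m dvd n \<Longrightarrow> F m \<subseteq> F n"
proof -
  assume "m dvd n"
  then obtain k where k: "n = m * k" by blast
  have "x ^ ((p ^ m) ^ k) = x" if "x ^ (p ^ m) = x" for x :: 'a
    using that by (induction k) (auto simp: power_mult)
  then show ?thesis by (auto simp: F_def k power_mult)
qed

text \<open>Substituting \<open>g * x\<close> for \<open>x\<close> multiplies the sum by
  \<open>f g\<close>, which differs from 1. Values in any \<open>idom\<close> serve both powers in
  the field and complex characters.\<close>

lemma sum_units_eq_0:
  fixes f :: "'a \<Rightarrow> 'b::idom"
  assumes "\<And>x y. x \<in> U n \<Longrightarrow> y \<in> U n \<Longrightarrow> f (x * y) = f x * f y"
    and "g \<in> U n" and "f g \<noteq> 1"
  shows "(\<Sum>x\<in>U n. f x) = 0"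
proof -
  have "(\<Sum>x\<in>U n. f x) = (\<Sum>x\<in>U n. f (g * x))"
    by (rule sum.reindex_bij_witness[of _ "\<lambda>x. g * x" "\<lambda>x. x / g"]) (use assms(2) in auto)
  also have "\<dots> = f g * (\<Sum>x\<in>U n. f x)"
    unfolding sum_distrib_left using assms(1,2) by (intro sum.cong) auto
  finally have "(f g - 1) * (\<Sum>x\<in>U n. f x) = 0" by (simp add: algebra_simps)
  then show ?thesis using assms(3) by simp
qed

text \<open>If \<open>p ^ n - 1\<close> divides \<open>k\<close>, all \<open>p ^ n - 1\<close> terms
  are 1, and their number is -1 in characteristic \<open>p\<close>. Otherwise a generator
  \<open>g\<close> has \<open>g ^ k \<noteq> 1\<close>.\<close>

lemma power_sum_units:
  assumes "n dvd M" "n > 0"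
  shows "(\<Sum>x\<in>U n. x ^ k) = (if (p ^ n - 1) dvd k then -1 else 0)"
proof (cases "(p ^ n - 1) dvd k")
  case True
  then obtain m where m: "k = (p ^ n - 1) * m" by blast
  have "(\<Sum>x\<in>U n. x ^ k) = (\<Sum>x\<in>U n. 1)"
    unfolding units_eq[OF assms(2)] by (intro sum.cong) (auto simp: m power_mult)
  also have "\<dots> = of_nat (p ^ n - 1)" by (simp add: card_units[OF assms])
  also have "\<dots> = -1" using assms(2) p_gt_1 of_nat_eq_0[of p] by (simp add: of_nat_diff zero_power)
  finally show ?thesis using True by simp
next
  case False
  obtain g :: 'a where g: "g \<noteq> 0" "\<And>i. g ^ i = 1 \<longleftrightarrow> (p ^ n - 1) dvd i"
    using exists_root_of_unity_of_order[OF dvd_minus_1[OF assms(1)]] by metis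
  have "g \<in> U n" unfolding units_eq[OF assms(2)] using g(2) by simp
  then have "(\<Sum>x\<in>U n. x ^ k) = 0"
    by (rule sum_units_eq_0[rotated]) (use g(2) False in \<open>auto simp: power_mult_distrib\<close>)
  then show ?thesis using False by simp
qed

section \<open>The absolute trace on subfields\<close>

lemma abs_trace_0 [simp]: "abs_trace p n (0::'a) = 0"
  using p_gt_1 by (simp add: abs_trace_def zero_power)

text \<open>Transitivity of the trace: the exponents \<open>i + j * n\<close> with
  \<open>i < n\<close> and \<open>j < k\<close> run once through all numbers below
  \<open>n * k\<close>.\<close>

lemma abs_trace_tower:
  "abs_trace p (n * k) (x::'a) = abs_trace p n (\<Sum>j<k. x ^ ((p ^ n) ^ j))"
proof -
  have "abs_trace p n (\<Sum>j<k. x ^ ((p ^ n) ^ j)) = (\<Sum>i<n. \<Sum>j<k. x ^ (p ^ (i + j * n)))"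
    unfolding abs_trace_def frob_sum
    by (intro sum.cong refl) (simp add: power_add mult.commute flip: power_mult)
  also have "\<dots> = (\<Sum>j<k. \<Sum>i<n. x ^ (p ^ (i + j * n)))" by (rule sum.swap)
  also have "\<dots> = (\<Sum>i<k * n. x ^ (p ^ i))" 
    unfolding sum.nat_group[of "\<lambda>i. x ^ (p ^ i)" n k, symmetric]
  proof (rule sum.cong[OF refl])
    fix j show "(\<Sum>i<n. x ^ (p ^ (i + j * n))) = (\<Sum>i = j * n..<j * n + n. x ^ (p ^ i))"
      using sum.shift_bounds_nat_ivl[of "\<lambda>i. x ^ (p ^ i)" 0 "j * n" n]
      by (simp add: add.commute atLeast0LessThan)
  qed
  finally show ?thesis by (simp add: abs_trace_def mult.commute)
qed

text \<open>Frobenius shifts the summands cyclically: the new last term \<open>x ^ (p ^ n)\<close>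
  is the old first one.\<close>

lemma abs_trace_in_F1:
  assumes "x \<in> F n"
  shows "abs_trace p n x \<in> F 1"
proof -
  have "abs_trace p n x ^ p = (\<Sum>i<n. x ^ (p ^ Suc i))"
    using frob_sum[of "\<lambda>i. x ^ (p ^ i)" "{..<n}" 1] by (simp add: abs_trace_def mult.commute flip: power_mult)
  also have "\<dots> = (\<Sum>i<Suc n. x ^ (p ^ i)) - x" by (subst sum.lessThan_Suc_shift) simp
  also have "\<dots> = abs_trace p n x" using assms by (simp add: abs_trace_def F_def)
  finally show ?thesis by (simp add: F_def)
qed

text \<open>The trace is a polynomial map of degree \<open>p ^ (n - 1)\<close>.\<close>

lemma card_trace_fibre_le:
  assumes "n > 0"
  shows "card {x::'a. abs_trace p n x = v} \<le> p ^ (n - 1)"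
proof -
  define f :: "'a poly" where "f = (\<Sum>i<n. monom 1 (p ^ i)) - [:v:]"
  have "degree f \<le> p ^ (n - 1)" unfolding f_def
  proof (intro degree_diff_le degree_sum_le)
    fix i assume "i \<in> {..<n}"
    then have "p ^ i \<le> p ^ (n - 1)" using p_gt_1 by (intro power_increasing) auto
    then show "degree (monom (1::'a) (p ^ i)) \<le> p ^ (n - 1)" using degree_monom_le le_trans by blast
  qed auto
  moreover have "coeff f (p ^ (n - 1)) = 1"
  proof -
    have "coeff f (p ^ (n - 1)) = (\<Sum>i<n. if i = n - 1 then 1 else 0)"
      unfolding f_def using p_gt_1
      by (simp add: coeff_sum coeff_pCons power_inject_exp split: nat.split)
    then show ?thesis using assms by simp
  qed
  then have "f \<noteq> 0" by auto
  then have "card {x. poly f x = 0} \<le> degree f" by (rule card_poly_roots_bound)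
  moreover have "{x. poly f x = 0} = {x. abs_trace p n x = v}"
    by (auto simp: f_def poly_sum poly_monom abs_trace_def)
  ultimately show ?thesis by simp
qed

text \<open>The \<open>p\<close> fibres over the prime field \<open>F 1\<close> cover all
  \<open>p ^ n\<close> elements, and none has more than \<open>p ^ (n - 1)\<close>, so the bound is
  attained over 0.\<close>

lemma card_trace_kernel:
  assumes "n dvd M" "n > 0"
  shows "card {x \<in> F n. abs_trace p n x = 0} = p ^ (n - 1)"
proof (rule antisym)
  have le: "card {x \<in> F n. abs_trace p n x = v} \<le> p ^ (n - 1)" for v
    using card_trace_fibre_le[OF assms(2), of v] card_mono[of "{x. abs_trace p n x = v}" "{x \<in> F n. abs_trace p n x = v}"]
    by force
  then show "card {x \<in> F n. abs_trace p n x = 0} \<le> p ^ (n - 1)" .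
  have one: "1 dvd M" by simp
  have "p ^ n = card (\<Union>v\<in>F 1. {x \<in> F n. abs_trace p n x = v})"
  proof -
    have "F n = (\<Union>v\<in>F 1. {x \<in> F n. abs_trace p n x = v})" using abs_trace_in_F1 by auto
    then show ?thesis using card_F[OF assms] by simp
  qed
  also have "\<dots> \<le> (\<Sum>v\<in>F 1. card {x \<in> F n. abs_trace p n x = v})" by (rule card_UN_le) simp
  also have "\<dots> = card {x \<in> F n. abs_trace p n x = 0} + (\<Sum>v\<in>U 1. card {x \<in> F n. abs_trace p n x = v})"
    by (subst sum.remove[of _ 0]) auto
  also have "(\<Sum>v\<in>U 1. card {x \<in> F n. abs_trace p n x = v}) \<le> (p - 1) * p ^ (n - 1)"
    using sum_bounded_above[of "U 1" "\<lambda>v. card {x \<in> F n. abs_trace p n x = v}" "p ^ (n - 1)"] le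
      card_units[OF one] by simp
  finally have "p ^ n \<le> card {x \<in> F n. abs_trace p n x = 0} + (p - 1) * p ^ (n - 1)" by simp
  moreover have "p ^ n = p ^ (n - 1) + (p - 1) * p ^ (n - 1)"
    using assms(2) p_gt_1 by (cases n) (auto simp: algebra_simps)
  ultimately show "p ^ (n - 1) \<le> card {x \<in> F n. abs_trace p n x = 0}" by linarith
qed

subsection \<open>Character sums in quadratic extensions\<close>

text \<open>The relative trace from \<open>F (2 * n)\<close> to \<open>F n\<close>.\<close>

definition T :: "nat \<Rightarrow> 'a \<Rightarrow> 'a" where
  "T n x = x + x ^ (p ^ n)"

lemma power_p_double: "(x::'a) ^ (p ^ (2 * n)) = (x ^ (p ^ n)) ^ (p ^ n)"
  by (simp add: mult_2 power_add power_mult)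

lemma rel_trace_0 [simp]: "T n 0 = 0"
  using p_gt_1 by (simp add: T_def power_0_left)

lemma rel_trace_1_nz: "T n x = 1 \<Longrightarrow> x \<noteq> 0"
  by auto

lemma rel_trace_in_F: "x \<in> F (2 * n) \<Longrightarrow> T n x \<in> F n"
  unfolding T_def F_def mem_Collect_eq power_p_double
  by (simp add: frob_add add.commute)

lemma rel_trace_scale: "s \<in> F n \<Longrightarrow> T n (s * x) = s * T n x"
  by (simp add: T_def F_def power_mult_distrib algebra_simps)

lemma rel_trace_add: "T n (x + y) = T n x + T n y"
  by (simp add: T_def frob_add)

lemma rel_trace_diff: "T n (x - y) = T n x - T n y"
  using rel_trace_add[of n x "- y"] by (simp add: T_def frob_minus)

lemma abs_trace_rel_trace: "abs_trace p (2 * n) x = abs_trace p n (T n x)"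
  using abs_trace_tower[of n 2 x] by (simp add: T_def mult.commute numeral_2_eq_2)

lemma F_double: "F n \<subseteq> F (2 * n)"
  by (rule F_mono) simp

text \<open>\<open>T n\<close> maps \<open>F (2 * n)\<close> into the smaller \<open>F n\<close>, so
  two elements share a trace; \<open>\<delta>\<close> is their difference.\<close>

lemma exists_rel_trace_0:
  assumes "2 * n dvd M" "n > 0"
  obtains \<delta> where "\<delta> \<in> U (2 * n)" "T n \<delta> = 0"
proof -
  have n: "n dvd M" using assms(1) by (metis dvd_mult_right)
  have "p ^ n < p ^ (2 * n)" using p_gt_1 assms(2) by (intro power_strict_increasing) auto
  then have "\<not> inj_on (T n) (F (2 * n))"
    using card_inj_on_le[of "T n" "F (2 * n)" "F n"] rel_trace_in_F assms n
    by (auto simp: card_F)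
  then obtain x y where "x \<in> F (2 * n)" "y \<in> F (2 * n)" "x \<noteq> y" "T n x = T n y"
    unfolding inj_on_def by blast
  moreover from this have "x + - y \<in> F (2 * n)" by blast
  ultimately show ?thesis using that[of "x - y"] by (simp add: rel_trace_diff)
qed

text \<open>Trace zero means that Frobenius negates \<open>\<delta>\<close>, so
  \<open>\<delta> ^ (p ^ n - 1) = -1\<close>. The remaining factor \<open>(p ^ n + 1) div 2\<close>
  of the exponent is odd since \<open>p ^ n mod 4 = 1\<close>. Thus \<open>\<delta>\<close> is not a
  square in \<open>F (2 * n)\<close>.\<close>

lemma rel_trace_0_power:
  assumes "\<delta> \<noteq> 0" "T n \<delta> = 0"
  shows "\<delta> ^ ((p ^ (2 * n) - 1) div 2) = -1"
proof -
  define h where "h = p ^ n div 4"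
  have P: "p ^ n = 4 * h + 1" unfolding h_def using p_pow_mod_4[of n] by presburger
  have "\<delta> * \<delta> ^ (4 * h) = \<delta> * (- 1)"
    using assms(2) by (simp add: T_def P add_eq_0_iff)
  then have m1: "\<delta> ^ (4 * h) = - 1" using assms(1) by (simp only: mult_cancel_left) simp
  have "p ^ (2 * n) = (4 * h + 1) * (4 * h + 1)" by (simp add: mult_2 power_add P)
  then have "(p ^ (2 * n) - 1) div 2 = 4 * h * (2 * h + 1)" by (simp add: algebra_simps)
  moreover have "\<delta> ^ (4 * h * (2 * h + 1)) = (\<delta> ^ (4 * h)) ^ (2 * h + 1)" by (rule power_mult)
  ultimately show ?thesis by (simp only: m1) simp
qed

text \<open>Two units of relative trace zero have a quotient fixed by Frobenius, so such units are
  the multiples of \<open>\<delta>\<close> by \<open>U n\<close>. Every other unit is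
  \<open>s * x\<close> for exactly one \<open>s\<close> in \<open>U n\<close> and one
  \<open>x\<close> of relative trace 1, \<open>s\<close> being its own relative trace.\<close>

lemma sum_tower:
  fixes f :: "'a \<Rightarrow> 'b::comm_monoid_add"
  assumes "\<delta> \<in> U (2 * n)" "T n \<delta> = 0"
  shows "(\<Sum>x\<in>U (2 * n). f x) =
    (\<Sum>s\<in>U n. f (\<delta> * s)) + (\<Sum>s\<in>U n. \<Sum>x | x \<in> F (2 * n) \<and> T n x = 1. f (s * x))"
proof -
  have "(\<Sum>x\<in>U (2 * n). f x) =
      (\<Sum>x | x \<in> U (2 * n) \<and> T n x = 0. f x) + (\<Sum>x | x \<in> U (2 * n) \<and> T n x \<noteq> 0. f x)"
    by (subst sum.union_disjoint[symmetric]) (auto intro: sum.cong)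
  also have "(\<Sum>x | x \<in> U (2 * n) \<and> T n x = 0. f x) = (\<Sum>s\<in>U n. f (\<delta> * s))"
  proof (rule sum.reindex_bij_witness[of _ "\<lambda>s. \<delta> * s" "\<lambda>x. x / \<delta>"])
    fix x assume x: "x \<in> {x \<in> U (2 * n). T n x = 0}"
    have "x ^ (p ^ n) = - x" "\<delta> ^ (p ^ n) = - \<delta>" using x assms(2) by (auto simp: T_def add_eq_0_iff)
    then show "x / \<delta> \<in> U n" using x assms(1) by (auto simp: F_def power_divide)
  next
    fix s assume "s \<in> U n"
    then show "\<delta> * s \<in> {x \<in> U (2 * n). T n x = 0}"
      using assms F_double rel_trace_scale[of s n \<delta>] by (auto simp: mult.commute)
  qed (use assms in auto)
  also have "(\<Sum>x | x \<in> U (2 * n) \<and> T n x \<noteq> 0. f x) =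
      (\<Sum>(s, x)\<in>U n \<times> {x. x \<in> F (2 * n) \<and> T n x = 1}. f (s * x))"
  proof (rule sum.reindex_bij_witness[of _ "\<lambda>(s, x). s * x" "\<lambda>x. (T n x, x / T n x)"])
    fix x assume x: "x \<in> {x \<in> U (2 * n). T n x \<noteq> 0}"
    have t: "T n x \<in> F n" using x rel_trace_in_F by auto
    then have "T n (inverse (T n x) * x) = 1"
      using rel_trace_scale[of "inverse (T n x)" n x] x by auto
    then show "(T n x, x / T n x) \<in> U n \<times> {x. x \<in> F (2 * n) \<and> T n x = 1}"
      using x t F_double by (auto simp: divide_inverse mult.commute)
  next
    fix b assume "b \<in> U n \<times> {x. x \<in> F (2 * n) \<and> T n x = 1}"
    then obtain s x where b: "b = (s, x)" "s \<in> U n" "x \<in> F (2 * n)" "T n x = 1" by auto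
    have "x \<noteq> 0" using b(4) by auto
    then show "(case b of (s, x) \<Rightarrow> s * x) \<in> {x \<in> U (2 * n). T n x \<noteq> 0}"
      "(T n (case b of (s, x) \<Rightarrow> s * x), (case b of (s, x) \<Rightarrow> s * x) / T n (case b of (s, x) \<Rightarrow> s * x)) = b"
      using b F_double rel_trace_scale[of s n x] by auto
  qed auto
  also have "\<dots> = (\<Sum>s\<in>U n. \<Sum>x | x \<in> F (2 * n) \<and> T n x = 1. f (s * x))"
    by (rule sum.cartesian_product[symmetric])
  finally show ?thesis .
qed

text \<open>Both Gauss-type sums needed are instances: the first summand survives for characters trivial
  on the smaller field, the second for the others.\<close>
lemma character_sum_trace_0:
  fixes \<chi> :: "'a \<Rightarrow> complex"
  assumes \<delta>: "\<delta> \<in> U (2 * n)" "T n \<delta> = 0"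
    and mult: "\<And>x y. x \<in> U (2 * n) \<Longrightarrow> y \<in> U (2 * n) \<Longrightarrow> \<chi> (x * y) = \<chi> x * \<chi> y"
  shows "(\<Sum>x | x \<in> U (2 * n) \<and> abs_trace p (2 * n) x = 0. \<chi> x) =
    \<chi> \<delta> * (\<Sum>s\<in>U n. \<chi> s) +
    (\<Sum>s | s \<in> U n \<and> abs_trace p n s = 0. \<chi> s) * (\<Sum>x | x \<in> F (2 * n) \<and> T n x = 1. \<chi> x)"
proof -
  let ?h = "\<lambda>s. if abs_trace p n s = 0 then 1 else 0 :: complex"
  have "(\<Sum>x | x \<in> U (2 * n) \<and> abs_trace p (2 * n) x = 0. \<chi> x) = (\<Sum>x\<in>U (2 * n). ?h (T n x) * \<chi> x)"
    by (subst sum.inter_filter) (simp, rule sum.cong, auto simp: abs_trace_rel_trace)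
  also have "\<dots> = (\<Sum>s\<in>U n. ?h (T n (\<delta> * s)) * \<chi> (\<delta> * s)) +
      (\<Sum>s\<in>U n. \<Sum>x | x \<in> F (2 * n) \<and> T n x = 1. ?h (T n (s * x)) * \<chi> (s * x))"
    by (rule sum_tower[OF \<delta>])
  also have "(\<Sum>s\<in>U n. ?h (T n (\<delta> * s)) * \<chi> (\<delta> * s)) = (\<Sum>s\<in>U n. \<chi> \<delta> * \<chi> s)"
  proof (rule sum.cong[OF refl])
    fix s assume s: "s \<in> U n"
    then have "T n (\<delta> * s) = 0" using rel_trace_scale[of s n \<delta>] \<delta> by (simp add: mult.commute)
    then show "?h (T n (\<delta> * s)) * \<chi> (\<delta> * s) = \<chi> \<delta> * \<chi> s"
      using s F_double \<delta> mult[of \<delta> s] by auto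
  qed
  also have "(\<Sum>s\<in>U n. \<Sum>x | x \<in> F (2 * n) \<and> T n x = 1. ?h (T n (s * x)) * \<chi> (s * x))
      = (\<Sum>s\<in>U n. \<Sum>x | x \<in> F (2 * n) \<and> T n x = 1. (?h s * \<chi> s) * \<chi> x)"
  proof (intro sum.cong refl)
    fix s x assume s: "s \<in> U n" and x: "x \<in> {x. x \<in> F (2 * n) \<and> T n x = 1}"
    then have "T n (s * x) = s" using rel_trace_scale[of s n x] by simp
    then show "?h (T n (s * x)) * \<chi> (s * x) = (?h s * \<chi> s) * \<chi> x"
      using s x F_double mult[of s x] rel_trace_1_nz[of n x] by auto
  qed
  also have "\<dots> = (\<Sum>s\<in>U n. ?h s * \<chi> s) * (\<Sum>x | x \<in> F (2 * n) \<and> T n x = 1. \<chi> x)"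
    by (simp only: sum_product)
  also have "(\<Sum>s\<in>U n. ?h s * \<chi> s) = (\<Sum>s | s \<in> U n \<and> abs_trace p n s = 0. \<chi> s)"
    by (subst sum.inter_filter) (simp, rule sum.cong, auto)
  finally show ?thesis by (simp add: sum_distrib_left)
qed

text \<open>The splitting of \<open>sum_tower\<close> with the character pulled out of both parts.
  When the sum over \<open>U n\<close> is nonzero, this determines the sum over relative trace
  1.\<close>

lemma character_sum_units:
  fixes \<chi> :: "'a \<Rightarrow> complex"
  assumes \<delta>: "\<delta> \<in> U (2 * n)" "T n \<delta> = 0"
    and mult: "\<And>x y. x \<in> U (2 * n) \<Longrightarrow> y \<in> U (2 * n) \<Longrightarrow> \<chi> (x * y) = \<chi> x * \<chi> y"
  shows "(\<Sum>x\<in>U (2 * n). \<chi> x) =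
    (\<Sum>s\<in>U n. \<chi> s) * (\<chi> \<delta> + (\<Sum>x | x \<in> F (2 * n) \<and> T n x = 1. \<chi> x))"
proof -
  have "(\<Sum>x\<in>U (2 * n). \<chi> x) =
      (\<Sum>s\<in>U n. \<chi> (\<delta> * s)) + (\<Sum>s\<in>U n. \<Sum>x | x \<in> F (2 * n) \<and> T n x = 1. \<chi> (s * x))"
    by (rule sum_tower[OF \<delta>])
  also have "(\<Sum>s\<in>U n. \<chi> (\<delta> * s)) = (\<Sum>s\<in>U n. \<chi> s * \<chi> \<delta>)"
    by (rule sum.cong[OF refl]) (use \<delta> F_double[of n] in \<open>auto simp: mult subset_iff\<close>)
  also have "(\<Sum>s\<in>U n. \<Sum>x | x \<in> F (2 * n) \<and> T n x = 1. \<chi> (s * x))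
      = (\<Sum>s\<in>U n. \<Sum>x | x \<in> F (2 * n) \<and> T n x = 1. \<chi> s * \<chi> x)"
    by (intro sum.cong refl) (use F_double[of n] in \<open>auto intro!: mult\<close>)
  also have "\<dots> = (\<Sum>s\<in>U n. \<chi> s) * (\<Sum>x | x \<in> F (2 * n) \<and> T n x = 1. \<chi> x)"
    by (simp only: sum_product)
  finally show ?thesis by (simp add: sum_distrib_right distrib_left)
qed

lemma card_units_trace_0:
  assumes "n dvd M" "n > 0"
  shows "card {s \<in> U n. abs_trace p n s = 0} = p ^ (n - 1) - 1"
proof -
  have "{s \<in> U n. abs_trace p n s = 0} = {s \<in> F n. abs_trace p n s = 0} - {0}" by auto
  then show ?thesis using card_trace_kernel[OF assms] by simp
qed

text \<open>As \<open>\<chi> \<delta> \<noteq> 1\<close>, the sum over all units vanishes, while the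
  sum over \<open>U n\<close> is \<open>p ^ n - 1\<close>; hence the bracket in
  \<open>character_sum_units\<close> is zero. The second claim then follows from
  \<open>character_sum_trace_0\<close>.\<close>

lemma character_sum_trivial_below:
  fixes \<chi> :: "'a \<Rightarrow> complex"
  assumes M: "2 * n dvd M" "n > 0"
    and \<delta>: "\<delta> \<in> U (2 * n)" "T n \<delta> = 0"
    and mult: "\<And>x y. x \<in> U (2 * n) \<Longrightarrow> y \<in> U (2 * n) \<Longrightarrow> \<chi> (x * y) = \<chi> x * \<chi> y"
    and triv: "\<And>s. s \<in> U n \<Longrightarrow> \<chi> s = 1"
    and nontriv: "\<chi> \<delta> \<noteq> 1"
  shows "(\<Sum>x | x \<in> F (2 * n) \<and> T n x = 1. \<chi> x) = - \<chi> \<delta>"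
    and "(\<Sum>x | x \<in> U (2 * n) \<and> abs_trace p (2 * n) x = 0. \<chi> x) = \<chi> \<delta> * (of_nat p ^ n - of_nat p ^ (n - 1))"
proof -
  have n: "n dvd M" using M(1) by (metis dvd_mult_right)
  have "p ^ n > 1" using p_gt_1 M(2) by (intro one_less_power)
  have c: "(\<Sum>s\<in>U n. \<chi> s) = of_nat p ^ n - 1"
    using triv card_units[OF n M(2)] \<open>p ^ n > 1\<close> by (simp add: of_nat_diff)
  have nz: "(\<Sum>s\<in>U n. \<chi> s) \<noteq> 0"
  proof -
    have "(\<Sum>s\<in>U n. \<chi> s) = of_nat (p ^ n - 1)" using triv card_units[OF n M(2)] by simp
    then show ?thesis using \<open>p ^ n > 1\<close> by (simp only: of_nat_eq_0_iff)
  qed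
  have "(\<Sum>x\<in>U (2 * n). \<chi> x) = 0" by (rule sum_units_eq_0[OF mult \<delta>(1) nontriv])
  then have "\<chi> \<delta> + (\<Sum>x | x \<in> F (2 * n) \<and> T n x = 1. \<chi> x) = 0"
    using character_sum_units[OF \<delta> mult] nz by simp
  then show S: "(\<Sum>x | x \<in> F (2 * n) \<and> T n x = 1. \<chi> x) = - \<chi> \<delta>"
    by (simp add: add_eq_0_iff)
  have "(\<Sum>s | s \<in> U n \<and> abs_trace p n s = 0. \<chi> s) = of_nat (card {s \<in> U n. abs_trace p n s = 0})"
    using triv by simp
  also have "\<dots> = of_nat p ^ (n - 1) - 1"
    using card_units_trace_0[OF n M(2)] p_gt_1 by (simp add: of_nat_diff)
  finally have H: "(\<Sum>s | s \<in> U n \<and> abs_trace p n s = 0. \<chi> s) = of_nat p ^ (n - 1) - 1" .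
  have "(\<Sum>x | x \<in> U (2 * n) \<and> abs_trace p (2 * n) x = 0. \<chi> x)
      = \<chi> \<delta> * (of_nat p ^ n - 1) + (of_nat p ^ (n - 1) - 1) * (- \<chi> \<delta>)"
    using character_sum_trace_0[OF \<delta> mult] by (simp only: c S H)
  also have "\<dots> = \<chi> \<delta> * (of_nat p ^ n - of_nat p ^ (n - 1))" by (simp add: algebra_simps)
  finally show "(\<Sum>x | x \<in> U (2 * n) \<and> abs_trace p (2 * n) x = 0. \<chi> x) = \<chi> \<delta> * (of_nat p ^ n - of_nat p ^ (n - 1))" .
qed

text \<open>\<open>S\<close> is traded for \<open>W\<close>, a sum over all units weighted by
  \<open>\<chi> (T n x)\<close>, which is \<open>p ^ n - 1\<close> times \<open>S\<close>. Expanding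
  \<open>W * cnj W\<close> and substituting \<open>x = z * y\<close> leaves only the
  \<open>z\<close> in \<open>F n\<close>.\<close>

lemma character_sum_norm:
  fixes \<chi> :: "'a \<Rightarrow> complex"
  assumes M: "2 * n dvd M" "n > 0"
    and \<delta>: "\<delta> \<in> U (2 * n)" "T n \<delta> = 0"
    and mult: "\<And>x y. x \<in> U (2 * n) \<Longrightarrow> y \<in> U (2 * n) \<Longrightarrow> \<chi> (x * y) = \<chi> x * \<chi> y"
    and unit: "\<And>x. x \<in> U (2 * n) \<Longrightarrow> \<chi> x * cnj (\<chi> x) = 1"
    and quad: "\<And>s. s \<in> U n \<Longrightarrow> \<chi> s = 1 \<or> \<chi> s = -1"
    and sum0: "(\<Sum>s\<in>U n. \<chi> s) = 0" and zero: "\<chi> 0 = 0"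
  defines "S \<equiv> (\<Sum>x | x \<in> F (2 * n) \<and> T n x = 1. \<chi> x)"
  shows "S * cnj S = of_nat p ^ n"
proof -
  define W where "W = (\<Sum>x\<in>U (2 * n). \<chi> x * \<chi> (T n x))"
  have n: "n dvd M" using M(1) by (metis dvd_mult_right)
  have P1: "p ^ n > 1" using p_gt_1 M(2) by (intro one_less_power)
  have cU: "of_nat (card (U n)) = (of_nat p ^ n - 1 :: complex)"
    using card_units[OF n M(2)] P1 by (simp add: of_nat_diff)
  have sq: "\<chi> s * \<chi> s = 1" if "s \<in> U n" for s using quad[OF that] by auto
  have real: "cnj (\<chi> s) = \<chi> s" if "s \<in> F n" for s
    using quad[of s] zero that by (cases "s = 0") auto
  \<comment> \<open>On \<open>U n\<close> the character has square 1, so the factors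
    \<open>\<chi> s\<close> coming from \<open>s * x\<close> and from its trace \<open>s\<close>
    cancel.\<close>
  have WS: "W = (of_nat p ^ n - 1) * S"
  proof -
    have "W = (\<Sum>s\<in>U n. \<chi> (\<delta> * s) * \<chi> (T n (\<delta> * s))) +
        (\<Sum>s\<in>U n. \<Sum>x | x \<in> F (2 * n) \<and> T n x = 1. \<chi> (s * x) * \<chi> (T n (s * x)))"
      unfolding W_def by (rule sum_tower[OF \<delta>])
    also have "(\<Sum>s\<in>U n. \<chi> (\<delta> * s) * \<chi> (T n (\<delta> * s))) = 0"
    proof (rule sum.neutral, rule ballI)
      fix s assume s: "s \<in> U n"
      then have "T n (\<delta> * s) = 0" using rel_trace_scale[of s n \<delta>] \<delta> by (simp add: mult.commute)
      then show "\<chi> (\<delta> * s) * \<chi> (T n (\<delta> * s)) = 0" by (simp add: zero)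
    qed
    also have "(\<Sum>s\<in>U n. \<Sum>x | x \<in> F (2 * n) \<and> T n x = 1. \<chi> (s * x) * \<chi> (T n (s * x)))
        = (\<Sum>s\<in>U n. \<Sum>x | x \<in> F (2 * n) \<and> T n x = 1. \<chi> x)"
    proof (intro sum.cong refl)
      fix s x assume s: "s \<in> U n" and x: "x \<in> {x. x \<in> F (2 * n) \<and> T n x = 1}"
      then have "T n (s * x) = s" using rel_trace_scale[of s n x] by simp
      moreover have "\<chi> (s * x) = \<chi> s * \<chi> x" using s x F_double mult[of s x] rel_trace_1_nz[of n x] by auto
      ultimately show "\<chi> (s * x) * \<chi> (T n (s * x)) = \<chi> x" using sq[OF s] by (simp add: mult_ac)
    qed
    finally show ?thesis using cU by (simp add: S_def)
  qed
  \<comment> \<open>For \<open>z\<close> outside \<open>F n\<close> the traces of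
    \<open>z * y\<close> and of \<open>y\<close> are independent coordinates of \<open>y\<close>, so
    the sum factors into two sums over \<open>F n\<close>, each of them zero.\<close>
  have inner0: "(\<Sum>y\<in>U (2 * n). \<chi> (T n (z * y)) * \<chi> (T n y)) = 0" if z: "z \<in> F (2 * n)" "z \<notin> F n" for z
  proof -
    let ?\<phi> = "\<lambda>y. (T n (z * y), T n y)"
    have inj: "inj_on ?\<phi> (F (2 * n))"
    proof (rule inj_onI)
      fix x y assume xy: "x \<in> F (2 * n)" "y \<in> F (2 * n)" "?\<phi> x = ?\<phi> y"
      then have "T n (x - y) = 0" "T n (z * (x - y)) = 0"
        by (auto simp: rel_trace_diff right_diff_distrib)
      then have "(x - y) ^ (p ^ n) = - (x - y)" "(z * (x - y)) ^ (p ^ n) = - (z * (x - y))"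
        by (auto simp: T_def add_eq_0_iff)
      then have "z ^ (p ^ n) * (x - y) = z * (x - y)"
        by (metis minus_mult_right neg_equal_iff_equal power_mult_distrib)
      then show "x = y" using z(2) by (auto simp: F_def)
    qed
    have im: "?\<phi> ` F (2 * n) = F n \<times> F n"
    proof (rule card_subset_eq)
      show "?\<phi> ` F (2 * n) \<subseteq> F n \<times> F n" using z rel_trace_in_F by auto
      show "card (?\<phi> ` F (2 * n)) = card (F n \<times> F n)"
        using card_image[OF inj] M n by (simp add: card_cartesian_product card_F mult_2 power_add)
    qed simp
    have "(\<Sum>y\<in>U (2 * n). \<chi> (T n (z * y)) * \<chi> (T n y)) = (\<Sum>y\<in>F (2 * n). \<chi> (T n (z * y)) * \<chi> (T n y))"
      by (rule sum.mono_neutral_left) (use zero in auto)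
    also have "\<dots> = (\<Sum>(a, b)\<in>?\<phi> ` F (2 * n). \<chi> a * \<chi> b)"
      by (subst sum.reindex[OF inj]) simp
    also have "\<dots> = (\<Sum>a\<in>F n. \<chi> a) * (\<Sum>b\<in>F n. \<chi> b)"
      unfolding im sum_product by (rule sum.cartesian_product[symmetric])
    also have "(\<Sum>b\<in>F n. \<chi> b) = (\<Sum>b\<in>U n. \<chi> b)"
      by (rule sum.mono_neutral_right) (use zero in auto)
    finally show ?thesis using sum0 by simp
  qed
  \<comment> \<open>For \<open>z\<close> in \<open>F n\<close> the factor \<open>z\<close> leaves
    the trace, and \<open>\<chi> (T n y)\<close> squares to 1 wherever the trace is nonzero. It
    remains to count those \<open>y\<close>.\<close>
  have inner1: "(\<Sum>y\<in>U (2 * n). \<chi> (T n (z * y)) * \<chi> (T n y)) = \<chi> z * ((of_nat p ^ n - 1) * of_nat p ^ n)"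
    if z: "z \<in> U n" for z
  proof -
    have split: "\<chi> (z * s) = \<chi> z * \<chi> s" if "s \<in> F n" for s
      using that z F_double mult[of z s] zero by (cases "s = 0") auto
    have "(\<Sum>y\<in>U (2 * n). \<chi> (T n (z * y)) * \<chi> (T n y)) = (\<Sum>y\<in>U (2 * n). \<chi> z * (\<chi> (T n y))\<^sup>2)"
      by (rule sum.cong[OF refl])
        (use z split rel_trace_in_F in \<open>auto simp: rel_trace_scale power2_eq_square\<close>)
    also have "\<dots> = \<chi> z * (\<Sum>y\<in>U (2 * n). if T n y = 0 then 0 else 1)"
      unfolding sum_distrib_left
    proof (rule sum.cong[OF refl])
      fix y assume "y \<in> U (2 * n)"
      then have "T n y \<in> F n" using rel_trace_in_F by auto
      then show "\<chi> z * (\<chi> (T n y))\<^sup>2 = \<chi> z * (if T n y = 0 then 0 else 1)"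
        using sq[of "T n y"] zero by (auto simp: power2_eq_square)
    qed
    also have "(\<Sum>y\<in>U (2 * n). if T n y = 0 then 0 else 1) = ((of_nat p ^ n - 1) * of_nat p ^ n :: complex)"
    proof -
      have "(\<Sum>y\<in>U (2 * n). if T n y = 0 then 0 else (1::complex))
          = (\<Sum>y\<in>U (2 * n). 1) - (\<Sum>y\<in>U (2 * n). if T n y = 0 then 1 else 0)"
        by (simp add: sum_subtractf[symmetric] del: sum_constant) (rule sum.cong, auto)
      also have "(\<Sum>y\<in>U (2 * n). if T n y = 0 then 1 else (0::complex)) = of_nat p ^ n - 1"
      proof -
        have "(\<Sum>y\<in>U (2 * n). if T n y = 0 then 1 else (0::complex)) =
          (\<Sum>s\<in>U n. if T n (\<delta> * s) = 0 then 1 else 0) +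
          (\<Sum>s\<in>U n. \<Sum>x | x \<in> F (2 * n) \<and> T n x = 1. if T n (s * x) = 0 then 1 else 0)"
          by (rule sum_tower[OF \<delta>])
        also have "(\<Sum>s\<in>U n. if T n (\<delta> * s) = 0 then 1 else (0::complex)) = (\<Sum>s\<in>U n. 1)"
          by (rule sum.cong[OF refl]) (use \<delta> in \<open>auto simp: rel_trace_scale mult.commute[of \<delta>]\<close>)
        also have "(\<Sum>s\<in>U n. \<Sum>x | x \<in> F (2 * n) \<and> T n x = 1. if T n (s * x) = 0 then 1 else (0::complex)) = 0"
          by (intro sum.neutral ballI) (auto simp: rel_trace_scale)
        finally show ?thesis using cU by simp
      qed
      also have "(\<Sum>y\<in>U (2 * n). (1::complex)) = of_nat p ^ (2 * n) - 1"
        using card_units[OF M(1)] M(2) p_gt_1 by (simp add: of_nat_diff)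
      finally show ?thesis by (simp add: algebra_simps flip: power_add mult_2)
    qed
    finally show ?thesis .
  qed
  have "W * cnj W = (\<Sum>y\<in>U (2 * n). \<Sum>x\<in>U (2 * n). (\<chi> x * \<chi> (T n x)) * cnj (\<chi> y * \<chi> (T n y)))"
    unfolding W_def cnj_sum by (subst mult.commute, subst sum_product) (simp add: mult.commute)
  also have "\<dots> = (\<Sum>y\<in>U (2 * n). \<Sum>z\<in>U (2 * n). \<chi> z * (\<chi> (T n (z * y)) * \<chi> (T n y)))"
  proof (rule sum.cong[OF refl])
    fix y assume y: "y \<in> U (2 * n)"
    then have Ty: "cnj (\<chi> (T n y)) = \<chi> (T n y)" using real rel_trace_in_F by auto
    have "(\<Sum>x\<in>U (2 * n). (\<chi> x * \<chi> (T n x)) * cnj (\<chi> y * \<chi> (T n y)))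
        = (\<Sum>z\<in>U (2 * n). (\<chi> (z * y) * \<chi> (T n (z * y))) * cnj (\<chi> y * \<chi> (T n y)))"
      by (rule sum.reindex_bij_witness[of _ "\<lambda>z. z * y" "\<lambda>x. x / y"]) (use y in auto)
    also have "\<dots> = (\<Sum>z\<in>U (2 * n). \<chi> z * (\<chi> (T n (z * y)) * \<chi> (T n y)))"
    proof (rule sum.cong[OF refl])
      fix z assume z: "z \<in> U (2 * n)"
      have "(\<chi> (z * y) * \<chi> (T n (z * y))) * cnj (\<chi> y * \<chi> (T n y))
          = \<chi> z * (\<chi> y * cnj (\<chi> y)) * (\<chi> (T n (z * y)) * \<chi> (T n y))"
        using mult[OF z y] Ty by (simp add: mult_ac)
      then show "(\<chi> (z * y) * \<chi> (T n (z * y))) * cnj (\<chi> y * \<chi> (T n y))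
          = \<chi> z * (\<chi> (T n (z * y)) * \<chi> (T n y))" using unit[OF y] by simp
    qed
    finally show "(\<Sum>x\<in>U (2 * n). (\<chi> x * \<chi> (T n x)) * cnj (\<chi> y * \<chi> (T n y)))
      = (\<Sum>z\<in>U (2 * n). \<chi> z * (\<chi> (T n (z * y)) * \<chi> (T n y)))" .
  qed
  also have "\<dots> = (\<Sum>z\<in>U (2 * n). \<Sum>y\<in>U (2 * n). \<chi> z * (\<chi> (T n (z * y)) * \<chi> (T n y)))"
    by (rule sum.swap)
  also have "\<dots> = (\<Sum>z\<in>U (2 * n). \<chi> z * (\<Sum>y\<in>U (2 * n). \<chi> (T n (z * y)) * \<chi> (T n y)))"
    by (simp add: sum_distrib_left)
  also have "\<dots> = (\<Sum>z\<in>U n. \<chi> z * (\<Sum>y\<in>U (2 * n). \<chi> (T n (z * y)) * \<chi> (T n y)))"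
    by (rule sum.mono_neutral_right) (use F_double inner0 in auto)
  also have "\<dots> = (\<Sum>z\<in>U n. (of_nat p ^ n - 1) * of_nat p ^ n)"
    by (rule sum.cong[OF refl]) (simp add: inner1 sq flip: mult.assoc)
  also have "\<dots> = (of_nat p ^ n - 1)\<^sup>2 * of_nat p ^ n"
    using cU by (simp add: power2_eq_square)
  finally have "(of_nat p ^ n - 1)\<^sup>2 * (S * cnj S) = (of_nat p ^ n - 1)\<^sup>2 * (of_nat p ^ n :: complex)"
    unfolding WS by (simp add: power2_eq_square mult_ac)
  moreover have "(of_nat p ^ n - 1 :: complex) \<noteq> 0"
  proof -
    have "card (U n) \<noteq> 0" using card_units[OF n M(2)] P1 by simp
    then show ?thesis using cU by (metis of_nat_eq_0_iff)
  qed
  ultimately show ?thesis by simp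
qed

end

section \<open>The quartic character\<close>

locale quartic_field = primitive_field p M \<omega> for p M and \<omega> :: "'a::{field,finite}" +
  fixes t :: nat and \<iota> :: 'a
  assumes t_pos: "t > 0" and t_dvd: "4 * t dvd M" and iota_sq: "\<iota> * \<iota> = -1"
begin

text \<open>\<open>c\<close> and \<open>e\<close> are a quarter of the orders of the unit groups of
  \<open>F (4 * t)\<close> and \<open>F (2 * t)\<close>. For a unit \<open>x\<close> of
  \<open>F (4 * t)\<close>, the fourth root of unity \<open>x ^ c\<close> names the coset of the
  fourth powers containing \<open>x\<close>.\<close>

definition c :: nat where "c = (p ^ (4 * t) - 1) div 4"
definition e :: nat where "e = (p ^ (2 * t) - 1) div 4"

text \<open>The value \<open>0\<close> off the fourth roots of unity yields \<open>\<chi> 0 = 0\<close>.\<close>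
definition \<theta> :: "'a \<Rightarrow> complex" where
  "\<theta> z = (if z = 1 then 1 else if z = \<iota> then \<i> else if z = -1 then -1 else if z = -\<iota> then -\<i> else 0)"

definition \<chi> :: "'a \<Rightarrow> complex" where "\<chi> x = \<theta> (x ^ c)"

lemma p_pow_2t: "p ^ (2 * t) = 4 * e + 1"
  unfolding e_def using p_pow_mod_4[of "2 * t"] by presburger

lemma p_pow_4t: "p ^ (4 * t) = (4 * e + 1) * (4 * e + 1)"
  unfolding p_pow_2t[symmetric] by (simp flip: power_add)

lemma c_eq: "c = e * (4 * e + 2)"
  unfolding c_def p_pow_4t by (simp add: algebra_simps)

lemma four_c: "4 * c = p ^ (4 * t) - 1"
  unfolding c_eq p_pow_4t by (simp add: algebra_simps)

lemma e_pos: "e > 0"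
proof -
  have "p ^ (2 * t) > 1" using p_gt_1 t_pos by (intro one_less_power) auto
  then show ?thesis using p_pow_2t by (cases e) auto
qed

lemma c_pos: "c > 0"
  using e_pos by (simp add: c_eq)

lemma dvd_2t: "2 * t dvd M"
  using t_dvd by (auto elim!: dvdE)

lemma minus_one_neq_one: "(-1::'a) \<noteq> 1"
  using two_nz by (metis add.right_inverse one_add_one)

lemma quartic_distinct:
  "\<iota> \<noteq> 1" "\<iota> \<noteq> -1" "-\<iota> \<noteq> 1" "-\<iota> \<noteq> -1" "\<iota> \<noteq> -\<iota>" "(-1::'a) \<noteq> 1" "(1::'a) \<noteq> -1"
  "-1 \<noteq> \<iota>" "1 \<noteq> \<iota>" "1 \<noteq> -\<iota>" "-\<iota> \<noteq> \<iota>"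
proof -
  show i1: "\<iota> \<noteq> 1" using iota_sq minus_one_neq_one by auto
  show i2: "\<iota> \<noteq> -1" using iota_sq minus_one_neq_one by auto
  show "-\<iota> \<noteq> 1" using i2 by (metis minus_minus)
  show "-\<iota> \<noteq> -1" using i1 by simp
  have i0: "\<iota> \<noteq> 0" using iota_sq by auto
  show i3: "\<iota> \<noteq> -\<iota>"
  proof
    assume "\<iota> = -\<iota>"
    then have "2 * \<iota> = 0" by (metis add.right_inverse mult_2)
    then show False using i0 two_nz by simp
  qed
  show "(-1::'a) \<noteq> 1" "(1::'a) \<noteq> -1" using minus_one_neq_one by auto
  show "-1 \<noteq> \<iota>" "1 \<noteq> \<iota>" "-\<iota> \<noteq> \<iota>" using i1 i2 i3 by auto
  show "1 \<noteq> -\<iota>" using i2 by (metis minus_minus)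
qed

lemma fourth_root_cases:
  assumes "z ^ 4 = (1::'a)"
  shows "z = 1 \<or> z = \<iota> \<or> z = -1 \<or> z = -\<iota>"
proof -
  have "(z - 1) * (z + 1) * ((z - \<iota>) * (z + \<iota>)) = (z * z - 1) * (z * z - \<iota> * \<iota>)"
    by (simp add: algebra_simps)
  also have "\<dots> = z ^ 4 - 1" unfolding iota_sq by (simp add: algebra_simps power4_eq_xxxx)
  finally have "(z - 1) * (z + 1) * ((z - \<iota>) * (z + \<iota>)) = 0" using assms by simp
  then show ?thesis by (auto simp: add_eq_0_iff2)
qed

lemma fourth_root_values:
  "\<theta> 1 = 1" "\<theta> \<iota> = \<i>" "\<theta> (-1) = -1" "\<theta> (-\<iota>) = -\<i>"
  using quartic_distinct by (auto simp: \<theta>_def)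

lemma \<theta>_mult:
  assumes "z ^ 4 = (1::'a)" "w ^ 4 = (1::'a)"
  shows "\<theta> (z * w) = \<theta> z * \<theta> w"
  using fourth_root_cases[OF assms(1)] fourth_root_cases[OF assms(2)]
  by (elim disjE) (simp_all add: fourth_root_values iota_sq)

lemma units_power_c: "x \<in> U (4 * t) \<Longrightarrow> (x ^ c) ^ 4 = 1"
  unfolding power_mult[symmetric] mult.commute[of c] four_c using units_eq[of "4 * t"] t_pos by auto

lemma \<chi>_mult: "x \<in> U (4 * t) \<Longrightarrow> y \<in> U (4 * t) \<Longrightarrow> \<chi> (x * y) = \<chi> x * \<chi> y"
  unfolding \<chi>_def power_mult_distrib by (intro \<theta>_mult units_power_c)

lemma \<chi>_0: "\<chi> 0 = 0"
  using c_pos quartic_distinct iota_sq by (auto simp: \<chi>_def \<theta>_def power_0_left)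

lemma \<chi>_unit: "x \<in> U (4 * t) \<Longrightarrow> \<chi> x * cnj (\<chi> x) = 1"
  using fourth_root_cases[OF units_power_c[of x]] unfolding \<chi>_def
  by (elim disjE meta_impE) (simp_all add: fourth_root_values)

text \<open>\<open>2 * c\<close> is a multiple of \<open>4 * e = p ^ (2 * t) - 1\<close>, so
  \<open>s ^ c\<close> squares to 1.\<close>

lemma \<chi>_below: "s \<in> U (2 * t) \<Longrightarrow> \<chi> s = 1 \<or> \<chi> s = -1"
proof -
  assume s: "s \<in> U (2 * t)"
  have "s ^ (4 * e) = 1" using s units_eq[of "2 * t"] t_pos by (simp add: p_pow_2t)
  moreover have "(s ^ c) ^ 2 = (s ^ (4 * e)) ^ (2 * e + 1)"
    unfolding c_eq power_mult[symmetric] by (simp add: algebra_simps)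
  ultimately have "(s ^ c) * (s ^ c) = 1" by (simp add: power2_eq_square)
  then have "s ^ c = 1 \<or> s ^ c = -1" by (simp add: square_eq_1_iff)
  then show ?thesis unfolding \<chi>_def using fourth_root_values by auto
qed

text \<open>Two levels down, \<open>c\<close> itself is a multiple of the group order
  \<open>p ^ t - 1\<close>.\<close>

lemma \<chi>_below_below: "s \<in> U t \<Longrightarrow> \<chi> s = 1"
proof -
  assume s: "s \<in> U t"
  have s1: "s ^ (p ^ t - 1) = 1" using s units_eq[of t] t_pos by simp
  define h where "h = p ^ t div 4"
  have P: "p ^ t = 4 * h + 1" unfolding h_def using p_pow_mod_4[of t] by presburger
  have "4 * e + 1 = (4 * h + 1) * (4 * h + 1)" unfolding P[symmetric] p_pow_2t[symmetric]
    by (simp add: mult_2 flip: power_add)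
  then have "e = 2 * h * (2 * h + 1)" by (simp add: algebra_simps)
  then have "c = 4 * h * ((2 * h + 1) * (2 * e + 1))" by (simp add: c_eq algebra_simps)
  then have "s ^ c = (s ^ (4 * h)) ^ ((2 * h + 1) * (2 * e + 1))" by (simp only: power_mult)
  then show ?thesis using s1 by (simp add: P \<chi>_def fourth_root_values)
qed

lemma U_subsets: "U t \<subseteq> U (2 * t)" "U (2 * t) \<subseteq> U (4 * t)"
  using F_double[of t] F_double[of "2 * t"] by auto

lemma double_2t: "2 * (2 * t) = 4 * t" by simp

text \<open>A unit of relative trace zero is no square, so its character value is
  \<open>\<i>\<close> or \<open>- \<i>\<close>. Which one depends on the choice of
  \<open>\<delta>\<close>, so the square is recorded.\<close>

lemma exists_\<delta>:
  obtains \<delta> where "\<delta> \<in> U (4 * t)" "T (2 * t) \<delta> = 0" "(\<chi> \<delta>)\<^sup>2 = -1"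
proof -
  obtain \<delta> where \<delta>: "\<delta> \<in> U (4 * t)" "T (2 * t) \<delta> = 0"
    using exists_rel_trace_0[of "2 * t"] t_dvd t_pos unfolding double_2t by auto
  have "\<delta> ^ ((p ^ (4 * t) - 1) div 2) = -1"
    using rel_trace_0_power[of \<delta> "2 * t"] \<delta> unfolding double_2t by simp
  then have "\<delta> ^ (2 * c) = -1" unfolding four_c[symmetric] by simp
  then have "\<delta> ^ c * \<delta> ^ c = -1" by (simp add: mult_2 power_add)
  then have "\<theta> (\<delta> ^ c) * \<theta> (\<delta> ^ c) = -1"
    using \<theta>_mult[OF units_power_c[OF \<delta>(1)] units_power_c[OF \<delta>(1)]] by (simp add: fourth_root_values)
  then show ?thesis using that[OF \<delta>] by (simp add: \<chi>_def power2_eq_square)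
qed

text \<open>One level lower, \<open>c\<close> is an odd multiple of \<open>2 * e\<close>, the
  exponent of \<open>rel_trace_0_power\<close>, which gives the definite value -1.\<close>

lemma exists_\<delta>':
  obtains \<delta> where "\<delta> \<in> U (2 * t)" "T t \<delta> = 0" "\<chi> \<delta> = -1"
proof -
  obtain \<delta> where \<delta>: "\<delta> \<in> U (2 * t)" "T t \<delta> = 0"
    using exists_rel_trace_0[OF dvd_2t t_pos] by auto
  have "\<delta> ^ ((p ^ (2 * t) - 1) div 2) = -1" using rel_trace_0_power[of \<delta> t] \<delta> by simp
  then have m1: "\<delta> ^ (2 * e) = -1" unfolding p_pow_2t by simp
  have "c = 2 * e * (2 * e + 1)" by (simp add: c_eq algebra_simps)
  then have "\<delta> ^ c = (\<delta> ^ (2 * e)) ^ (2 * e + 1)" by (simp only: power_mult)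
  also have "\<dots> = -1" unfolding m1 by simp
  finally show ?thesis using that[OF \<delta>] by (simp add: \<chi>_def fourth_root_values)
qed

section \<open>The sum over relative trace 1: value, norm and parity\<close>

abbreviation "X1 \<equiv> {x. x \<in> F (4 * t) \<and> T (2 * t) x = 1}"

text \<open>An Eisenstein sum of the quadratic extension \<open>F (4 * t)\<close> over
  \<open>F (2 * t)\<close>.\<close>

definition S :: complex where "S = (\<Sum>x\<in>X1. \<chi> x)"

lemma X1_units: "X1 \<subseteq> U (4 * t)"
  by auto

lemma sum_\<chi>_below: "(\<Sum>s\<in>U (2 * t). \<chi> s) = 0"
proof -
  obtain \<delta> where \<delta>: "\<delta> \<in> U (2 * t)" "T t \<delta> = 0" "\<chi> \<delta> = -1" by (rule exists_\<delta>')
  show ?thesis by (rule sum_units_eq_0[OF _ \<delta>(1)]) (use U_subsets \<delta> in \<open>auto intro!: \<chi>_mult\<close>)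
qed

text \<open>Restricted to \<open>F (2 * t)\<close> the character is quadratic and trivial on
  \<open>F t\<close>, so \<open>character_sum_trivial_below\<close> applies to the lower quadratic
  step.\<close>

lemma sum_\<chi>_trace_0_below:
  "(\<Sum>s | s \<in> U (2 * t) \<and> abs_trace p (2 * t) s = 0. \<chi> s) = - (of_nat p ^ t - of_nat p ^ (t - 1))"
proof -
  obtain \<delta> where \<delta>: "\<delta> \<in> U (2 * t)" "T t \<delta> = 0" "\<chi> \<delta> = -1" by (rule exists_\<delta>')
  have "(\<Sum>s | s \<in> U (2 * t) \<and> abs_trace p (2 * t) s = 0. \<chi> s) = \<chi> \<delta> * (of_nat p ^ t - of_nat p ^ (t - 1))"
    by (rule character_sum_trivial_below(2)[OF dvd_2t t_pos \<delta>(1,2)])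
      (use U_subsets \<delta> in \<open>auto intro!: \<chi>_mult \<chi>_below_below\<close>)
  then show ?thesis using \<delta>(3) by simp
qed

text \<open>The first summand of \<open>character_sum_trace_0\<close> vanishes,
  \<open>\<chi>\<close> being nontrivial on \<open>F (2 * t)\<close>; the second is the preceding
  value times \<open>S\<close>.\<close>

lemma sum_\<chi>_trace_0:
  "(\<Sum>x | x \<in> U (4 * t) \<and> abs_trace p (4 * t) x = 0. \<chi> x) = - (of_nat p ^ t - of_nat p ^ (t - 1)) * S"
proof -
  obtain \<delta> where \<delta>: "\<delta> \<in> U (4 * t)" "T (2 * t) \<delta> = 0" "(\<chi> \<delta>)\<^sup>2 = -1" by (rule exists_\<delta>)
  show ?thesis
    using character_sum_trace_0[of \<delta> "2 * t" \<chi>] \<delta> \<chi>_mult sum_\<chi>_below sum_\<chi>_trace_0_below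
    unfolding double_2t S_def by simp
qed

text \<open>The square of \<open>\<chi>\<close> is trivial on \<open>F (2 * t)\<close> and is -1 at
  \<open>\<delta>\<close>, so it falls under \<open>character_sum_trivial_below\<close> in the upper
  step.\<close>

lemma sum_\<chi>2:
  shows "(\<Sum>x\<in>X1. (\<chi> x)\<^sup>2) = 1"
    and "(\<Sum>x | x \<in> U (4 * t) \<and> abs_trace p (4 * t) x = 0. (\<chi> x)\<^sup>2)
      = - (of_nat p ^ (2 * t) - of_nat p ^ (2 * t - 1))"
proof -
  obtain \<delta> where \<delta>: "\<delta> \<in> U (4 * t)" "T (2 * t) \<delta> = 0" "(\<chi> \<delta>)\<^sup>2 = -1" by (rule exists_\<delta>)
  have 1: "2 * (2 * t) dvd M" "2 * t > 0" "\<delta> \<in> U (2 * (2 * t))" "T (2 * t) \<delta> = 0"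
    using t_dvd t_pos \<delta> unfolding double_2t by auto
  have 2: "(\<chi> (x * y))\<^sup>2 = (\<chi> x)\<^sup>2 * (\<chi> y)\<^sup>2" if "x \<in> U (2 * (2 * t))" "y \<in> U (2 * (2 * t))" for x y
    using that \<chi>_mult[of x y] unfolding double_2t by (simp add: power_mult_distrib)
  have 3: "(\<chi> s)\<^sup>2 = 1" if "s \<in> U (2 * t)" for s using \<chi>_below[OF that] by auto
  have 4: "(\<chi> \<delta>)\<^sup>2 \<noteq> 1" using \<delta> by simp
  show "(\<Sum>x\<in>X1. (\<chi> x)\<^sup>2) = 1"
    using character_sum_trivial_below(1)[of "2 * t" \<delta> "\<lambda>x. (\<chi> x)\<^sup>2", OF 1 2 3 4] \<delta>(3)
    unfolding double_2t by simp
  show "(\<Sum>x | x \<in> U (4 * t) \<and> abs_trace p (4 * t) x = 0. (\<chi> x)\<^sup>2)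
      = - (of_nat p ^ (2 * t) - of_nat p ^ (2 * t - 1))"
    using character_sum_trivial_below(2)[of "2 * t" \<delta> "\<lambda>x. (\<chi> x)\<^sup>2", OF 1 2 3 4] \<delta>(3)
    unfolding double_2t by simp
qed

text \<open>This is \<open>character_sum_units\<close> for the constant character 1, read as a
  count.\<close>

lemma card_X1: "card X1 = p ^ (2 * t)"
proof -
  obtain \<delta> where \<delta>: "\<delta> \<in> U (4 * t)" "T (2 * t) \<delta> = 0" "(\<chi> \<delta>)\<^sup>2 = -1" by (rule exists_\<delta>)
  have "(of_nat (card (U (4 * t))) :: complex) = of_nat (card (U (2 * t))) * (1 + of_nat (card X1))"
    using character_sum_units[of \<delta> "2 * t" "\<lambda>_. 1"] \<delta> unfolding double_2t by simp
  also have "\<dots> = of_nat (card (U (2 * t)) * (1 + card X1))" by (simp only: of_nat_mult of_nat_add of_nat_1)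
  finally have "(of_nat (card (U (4 * t))) :: complex) = of_nat (card (U (2 * t)) * (1 + card X1))" .
  then have "card (U (4 * t)) = card (U (2 * t)) * (1 + card X1)" by (simp only: of_nat_eq_iff)
  then have "4 * e * (4 * e + 2) = 4 * e * (1 + card X1)"
    using card_units[OF t_dvd] card_units[OF dvd_2t] t_pos four_c p_pow_2t by (simp add: c_eq)
  then have "4 * e + 2 = 1 + card X1" using e_pos by (simp only: mult_cancel1) simp
  then show ?thesis using p_pow_2t by simp
qed

lemma S_norm: "S * cnj S = of_nat p ^ (2 * t)"
proof -
  obtain \<delta> where \<delta>: "\<delta> \<in> U (4 * t)" "T (2 * t) \<delta> = 0" "(\<chi> \<delta>)\<^sup>2 = -1" by (rule exists_\<delta>)
  show ?thesis
    using character_sum_norm[of "2 * t" \<delta> \<chi>] \<delta> t_dvd t_pos \<chi>_mult \<chi>_unit \<chi>_below sum_\<chi>_below \<chi>_0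
    unfolding double_2t S_def by simp
qed

text \<open>The semiring is left open because \<open>g\<close> takes values in the complex numbers,
  in the integers and in the finite field.\<close>

lemma sum_by_quartic_class:
  fixes g :: "'a \<Rightarrow> 'b::comm_semiring_1"
  assumes "X \<subseteq> U (4 * t)"
  shows "(\<Sum>x\<in>X. g (x ^ c)) = of_nat (card {x\<in>X. x ^ c = 1}) * g 1 + of_nat (card {x\<in>X. x ^ c = \<iota>}) * g \<iota>
    + of_nat (card {x\<in>X. x ^ c = -1}) * g (-1) + of_nat (card {x\<in>X. x ^ c = -\<iota>}) * g (-\<iota>)"
proof -
  have "(\<Sum>x\<in>X. g (x ^ c)) = (\<Sum>z\<in>{1, \<iota>, -1, -\<iota>}. \<Sum>x | x \<in> X \<and> x ^ c = z. g (x ^ c))"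
    by (rule sum.group[symmetric]) (use assms fourth_root_cases[OF units_power_c] in auto)
  also have "\<dots> = (\<Sum>z\<in>{1, \<iota>, -1, -\<iota>}. of_nat (card {x\<in>X. x ^ c = z}) * g z)"
    by (rule sum.cong[OF refl]) simp
  finally show ?thesis using quartic_distinct by (simp add: add.assoc)
qed

definition A :: int where
  "A = int (card {x\<in>X1. x ^ c = 1}) - int (card {x\<in>X1. x ^ c = -1})"
definition B :: int where
  "B = int (card {x\<in>X1. x ^ c = \<iota>}) - int (card {x\<in>X1. x ^ c = -\<iota>})"

lemma S_eq: "S = of_int A + \<i> * of_int B"
  unfolding S_def \<chi>_def sum_by_quartic_class[OF X1_units, of \<theta>] A_def B_def
  by (simp add: fourth_root_values algebra_simps)

lemma A_B_norm: "A\<^sup>2 + B\<^sup>2 = int p ^ (2 * t)"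
proof -
  have "complex_of_int (A\<^sup>2 + B\<^sup>2) = S * cnj S"
    unfolding S_eq by (simp add: algebra_simps power2_eq_square)
  also have "\<dots> = of_int (int p ^ (2 * t))" unfolding S_norm by simp
  finally show ?thesis by (simp only: of_int_eq_iff)
qed

text \<open>The sum of the squared character is 1 and the total is \<open>4 * e + 1\<close>;
  together they put \<open>2 * e + 1\<close> elements into the classes of 1 and -1, and
  \<open>A\<close> has the parity of this number.\<close>

lemma odd_A: "odd A"
proof -
  let ?n = "\<lambda>z. int (card {x\<in>X1. x ^ c = z})"
  have "complex_of_int (?n 1 - ?n \<iota> + ?n (-1) - ?n (-\<iota>)) = of_int 1"
    using sum_by_quartic_class[OF X1_units, of "\<lambda>z. (\<theta> z)\<^sup>2"] sum_\<chi>2(1)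
    unfolding \<chi>_def[symmetric] by (simp add: fourth_root_values)
  then have 1: "?n 1 - ?n \<iota> + ?n (-1) - ?n (-\<iota>) = 1" by (simp only: of_int_eq_iff)
  have 2: "?n 1 + ?n \<iota> + ?n (-1) + ?n (-\<iota>) = 4 * int e + 1"
    using sum_by_quartic_class[OF X1_units, of "\<lambda>z. 1::int"] card_X1 p_pow_2t by simp
  have "?n 1 = 2 * int e + 1 - ?n (-1)" using 1 2 by linarith
  then have "A = 2 * (int e - ?n (-1)) + 1" unfolding A_def by simp
  then show ?thesis by simp
qed

lemma even_B: "even B"
proof -
  have "odd (int p ^ (2 * t))" using odd_p_pow[of "2 * t"] by (metis even_of_nat of_nat_power)
  then have "odd (A\<^sup>2 + B\<^sup>2)" unfolding A_B_norm .
  then show ?thesis using odd_A by simp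
qed

section \<open>Reduction of \<open>S\<close> modulo \<open>p\<close>\<close>

text \<open>The left side is the conjugate of \<open>S\<close> with \<open>\<i>\<close> read as
  \<open>\<iota>\<close> in the finite field. Its value comes from evaluating one sum over
  \<open>U (4 * t)\<close> twice, by \<open>sum_tower\<close> and by binomial expansion of the
  trace.\<close>

lemma sum_power_3c: "(\<Sum>x\<in>X1. x ^ (3 * c)) = of_nat (2 * e choose e)"
proof -
  obtain \<delta> where \<delta>: "\<delta> \<in> U (4 * t)" "T (2 * t) \<delta> = 0" "(\<chi> \<delta>)\<^sup>2 = -1" by (rule exists_\<delta>)
  \<comment> \<open>The power of the trace is 1 on \<open>X1\<close> and kills the trace-zero part.
    Its exponent makes \<open>3 * c + 2 * e\<close> a multiple of \<open>4 * e\<close>, so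
    \<open>?f\<close> is invariant under scaling by \<open>U (2 * t)\<close>.\<close>
  let ?f = "\<lambda>x. x ^ (3 * c) * (T (2 * t) x) ^ (2 * e)"
  have "(\<Sum>x\<in>U (4 * t). ?f x) = (\<Sum>s\<in>U (2 * t). ?f (\<delta> * s)) + (\<Sum>s\<in>U (2 * t). \<Sum>x\<in>X1. ?f (s * x))"
    using sum_tower[of \<delta> "2 * t" ?f] \<delta> unfolding double_2t by simp
  also have "(\<Sum>s\<in>U (2 * t). ?f (\<delta> * s)) = 0"
    by (intro sum.neutral ballI)
      (use \<delta> e_pos in \<open>auto simp: mult.commute[of \<delta>] rel_trace_scale power_0_left\<close>)
  also have "(\<Sum>s\<in>U (2 * t). \<Sum>x\<in>X1. ?f (s * x)) = (\<Sum>s\<in>U (2 * t). \<Sum>x\<in>X1. x ^ (3 * c))"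
  proof (intro sum.cong refl)
    fix s x assume s: "s \<in> U (2 * t)" and x: "x \<in> X1"
    have "s ^ (4 * e) = 1" using s units_eq[of "2 * t"] t_pos by (simp add: p_pow_2t)
    moreover have "s ^ (3 * c) * s ^ (2 * e) = (s ^ (4 * e)) ^ (3 * e + 2)"
      unfolding c_eq power_add[symmetric] power_mult[symmetric] by (simp add: algebra_simps)
    ultimately have "s ^ (3 * c) * s ^ (2 * e) = 1" by simp
    moreover have "T (2 * t) (s * x) = s" using s x rel_trace_scale[of s "2 * t" x] by simp
    ultimately show "?f (s * x) = x ^ (3 * c)" by (simp add: power_mult_distrib mult_ac)
  qed
  also have "\<dots> = of_nat (card (U (2 * t))) * (\<Sum>x\<in>X1. x ^ (3 * c))" by simp
  also have "of_nat (card (U (2 * t))) = (-1::'a)"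
    using power_sum_units[OF dvd_2t, of 0] t_pos by simp
  finally have 1: "(\<Sum>x\<in>U (4 * t). ?f x) = - (\<Sum>x\<in>X1. x ^ (3 * c))" by simp
  have "(\<Sum>x\<in>U (4 * t). ?f x)
      = (\<Sum>x\<in>U (4 * t). \<Sum>j\<le>2 * e. of_nat (2 * e choose j) * x ^ (4 * e * (5 * e + 2 - j)))"
  proof (rule sum.cong[OF refl])
    fix x
    have "?f x = (\<Sum>j\<le>2 * e. x ^ (3 * c) * (of_nat (2 * e choose j) * x ^ j * (x ^ (p ^ (2 * t))) ^ (2 * e - j)))"
      unfolding T_def binomial_ring sum_distrib_left ..
    also have "\<dots> = (\<Sum>j\<le>2 * e. of_nat (2 * e choose j) * x ^ (4 * e * (5 * e + 2 - j)))"
    proof (rule sum.cong[OF refl])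
      fix j assume "j \<in> {..2 * e}"
      then obtain k where k: "2 * e = j + k" by (auto simp: le_iff_add)
      have ek: "5 * e + 2 - j = 3 * e + k + 2" "2 * e - j = k" using k by auto
      have "3 * c + j + (4 * e + 1) * k = 3 * c + 2 * e + 4 * e * k" using k by (simp add: algebra_simps)
      also have "\<dots> = 4 * e * (3 * e + k + 2)" by (simp add: c_eq algebra_simps)
      finally have ex: "3 * c + j + (4 * e + 1) * k = 4 * e * (3 * e + k + 2)" .
      have "x ^ (3 * c) * (of_nat (2 * e choose j) * x ^ j * (x ^ (p ^ (2 * t))) ^ (2 * e - j))
          = of_nat (2 * e choose j) * x ^ (3 * c + j + (4 * e + 1) * k)"
        unfolding p_pow_2t ek power_mult[symmetric, of x "4 * e + 1" k] power_add[of x _ "(4 * e + 1) * k"]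
          power_add[of x "3 * c"] by (simp only: mult_ac)
      then show "x ^ (3 * c) * (of_nat (2 * e choose j) * x ^ j * (x ^ (p ^ (2 * t))) ^ (2 * e - j))
          = of_nat (2 * e choose j) * x ^ (4 * e * (5 * e + 2 - j))"
        unfolding ex ek .
    qed
    finally show "?f x = (\<Sum>j\<le>2 * e. of_nat (2 * e choose j) * x ^ (4 * e * (5 * e + 2 - j)))" .
  qed
  also have "\<dots> = (\<Sum>j\<le>2 * e. of_nat (2 * e choose j) * (\<Sum>x\<in>U (4 * t). x ^ (4 * e * (5 * e + 2 - j))))"
    unfolding sum_distrib_left by (rule sum.swap)
  \<comment> \<open>By \<open>power_sum_units\<close> only exponents divisible by
    \<open>4 * e * (4 * e + 2)\<close> survive. For \<open>j \<le> 2 * e\<close> the number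
    \<open>5 * e + 2 - j\<close> lies between \<open>3 * e + 2\<close> and \<open>5 * e + 2\<close>,
    and the only multiple of \<open>4 * e + 2\<close> there is itself.\<close>
  also have "\<dots> = (\<Sum>j\<le>2 * e. if j = e then - of_nat (2 * e choose e) else 0)"
  proof (rule sum.cong[OF refl])
    fix j assume j: "j \<in> {..2 * e}"
    have "(p ^ (4 * t) - 1) dvd 4 * e * (5 * e + 2 - j) \<longleftrightarrow> (4 * e + 2) dvd (5 * e + 2 - j)"
      unfolding four_c[symmetric] c_eq mult.assoc[symmetric]
      by (rule dvd_times_left_cancel_iff) (use e_pos in simp)
    also have "\<dots> \<longleftrightarrow> j = e"
    proof
      assume "(4 * e + 2) dvd (5 * e + 2 - j)"
      then obtain k where k: "5 * e + 2 - j = (4 * e + 2) * k" by blast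
      have "k = 1"
      proof (rule ccontr)
        assume "k \<noteq> 1"
        then consider "k = 0" | "k \<ge> 2" by linarith
        then show False
        proof cases
          case 1 then show False using k j by simp
        next
          case 2
          then have "(4 * e + 2) * 2 \<le> (4 * e + 2) * k" by (rule mult_le_mono2)
          then have "(4 * e + 2) * 2 \<le> 5 * e + 2 - j" by (simp only: k)
          also have "\<dots> \<le> 5 * e + 2" by simp
          finally show False by simp
        qed
      qed
      then show "j = e" using k j by simp
    qed auto
    finally show "of_nat (2 * e choose j) * (\<Sum>x\<in>U (4 * t). x ^ (4 * e * (5 * e + 2 - j)))
        = (if j = e then - of_nat (2 * e choose e) else 0)"
      using power_sum_units[OF t_dvd, of "4 * e * (5 * e + 2 - j)"] t_pos by simp
  qed
  also have "\<dots> = - of_nat (2 * e choose e)" by simp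
  finally show ?thesis using 1 by simp
qed

text \<open>If \<open>p\<close> divided \<open>A\<close>, it would divide \<open>B\<close> by the
  norm equation, and the sum of \<open>x ^ (3 * c)\<close> would vanish in the field; but that sum
  is a central binomial coefficient prime to \<open>p\<close>.\<close>

lemma not_p_dvd_A: "\<not> int p dvd A"
proof
  assume A: "int p dvd A"
  have pp: "prime (int p)" using prime_p by simp
  have "int p dvd int p ^ (2 * t) - A\<^sup>2" using A t_pos by (simp add: power2_eq_square)
  then have "int p dvd B\<^sup>2" using A_B_norm by (metis add_diff_cancel_left')
  then have B: "int p dvd B" using pp prime_dvd_power by blast
  have z: "of_int k = (0::'a)" if "int p dvd k" for k
    using that of_nat_eq_0[of p] by (metis dvd_def dvd_refl mult_zero_left of_int_mult of_int_of_nat_eq)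
  have i3: "\<iota> ^ 3 = -\<iota>" "(-\<iota>) ^ 3 = \<iota>" using iota_sq by (simp_all add: power3_eq_cube)
  have "of_nat (2 * e choose e) = (\<Sum>x\<in>X1. (x ^ c) ^ 3)"
    unfolding sum_power_3c[symmetric] by (simp add: mult.commute flip: power_mult)
  also have "\<dots> = of_int A - \<iota> * of_int B"
    unfolding sum_by_quartic_class[OF X1_units, of "\<lambda>z. z ^ 3"] A_def B_def i3
    by (simp add: algebra_simps)
  also have "\<dots> = 0" using z[OF A] z[OF B] by simp
  finally have "p dvd (2 * e choose e)" using of_nat_eq_0 by simp
  then show False using not_dvd_central_binomial[OF prime_p p_mod_4, of "2 * t"] by (simp add: e_def)
qed

text \<open>Orthogonality of the four powers of the quartic character isolates one coset of the
  fourth powers.\<close>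
lemma card_coset_trace_0:
  assumes y: "y \<in> U (4 * t)"
  shows "4 * complex_of_nat (card {x \<in> U (4 * t). x ^ c = y ^ c \<and> abs_trace p (4 * t) x = 0})
    = of_nat p ^ (4 * t - 1) - 1 - (\<chi> y)\<^sup>2 * (of_nat p ^ (2 * t) - of_nat p ^ (2 * t - 1))
      - (of_nat p ^ t - of_nat p ^ (t - 1)) * (cnj (\<chi> y) * S + \<chi> y * cnj S)"
proof -
  let ?K = "{x. x \<in> U (4 * t) \<and> abs_trace p (4 * t) x = 0}"
  have ind: "1 + \<theta> z * cnj (\<theta> w) + (\<theta> z)\<^sup>2 * (\<theta> w)\<^sup>2 + cnj (\<theta> z) * \<theta> w = (if z = w then 4 else 0)"
    if "z ^ 4 = 1" "w ^ 4 = 1" for z w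
    using fourth_root_cases[OF that(1)] fourth_root_cases[OF that(2)] quartic_distinct
    by (elim disjE) (simp_all add: fourth_root_values)
  have "4 * complex_of_nat (card {x \<in> U (4 * t). x ^ c = y ^ c \<and> abs_trace p (4 * t) x = 0})
      = (\<Sum>x\<in>?K. if x ^ c = y ^ c then 4 else 0)"
  proof -
    have "{x \<in> U (4 * t). x ^ c = y ^ c \<and> abs_trace p (4 * t) x = 0} = {x\<in>?K. x ^ c = y ^ c}" by auto
    then show ?thesis by (simp add: sum.inter_filter[symmetric])
  qed
  also have "\<dots> = (\<Sum>x\<in>?K. 1 + \<chi> x * cnj (\<chi> y) + (\<chi> x)\<^sup>2 * (\<chi> y)\<^sup>2 + cnj (\<chi> x) * \<chi> y)"
    by (rule sum.cong[OF refl], unfold \<chi>_def, subst ind) (use y units_power_c in auto)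
  also have "\<dots> = of_nat (card ?K) + (\<Sum>x\<in>?K. \<chi> x) * cnj (\<chi> y) + (\<Sum>x\<in>?K. (\<chi> x)\<^sup>2) * (\<chi> y)\<^sup>2
      + cnj (\<Sum>x\<in>?K. \<chi> x) * \<chi> y"
    by (simp add: sum.distrib sum_distrib_right)
  also have "of_nat (card ?K) = (of_nat p ^ (4 * t - 1) - 1 :: complex)"
    using card_units_trace_0[OF t_dvd] t_pos p_gt_1 by (simp add: of_nat_diff)
  finally show ?thesis
    unfolding sum_\<chi>_trace_0 sum_\<chi>2(2) by (simp add: algebra_simps)
qed

section \<open>Cosets of the fourth powers and their weights\<close>

lemma c_dvd: "c dvd p ^ M - 1"
  using dvd_minus_1[OF t_dvd] unfolding four_c[symmetric] by (rule dvd_mult_right)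

lemma coset_in_units: "y \<in> U (4 * t) \<Longrightarrow> x ^ c = y ^ c \<Longrightarrow> x \<in> U (4 * t)"
proof -
  assume y: "y \<in> U (4 * t)" and xy: "x ^ c = y ^ c"
  have "(x ^ c) ^ 4 = 1" unfolding xy by (rule units_power_c[OF y])
  then have "x ^ (4 * c) = 1" by (simp add: mult.commute flip: power_mult)
  moreover have "U (4 * t) = {x. x ^ (p ^ (4 * t) - 1) = 1}" using t_pos by (intro units_eq) simp
  ultimately show ?thesis unfolding four_c by blast
qed

lemma coset_eq: "y \<noteq> 0 \<Longrightarrow> {x. x ^ c = y ^ c} = (*) y ` {x. x ^ c = 1}" for y :: 'a
proof (intro equalityI subsetI)
  fix x assume "y \<noteq> 0" "x \<in> {x. x ^ c = y ^ c}"
  then show "x \<in> (*) y ` {x. x ^ c = 1}"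
    by (intro image_eqI[of _ _ "x / y"]) (auto simp: power_divide)
qed (auto simp: power_mult_distrib)

text \<open>Some power of a generator lies in the class of \<open>z\<close>, so the class is a coset
  of the \<open>c\<close>-th roots of unity.\<close>

lemma card_quartic_class:
  assumes "z ^ 4 = 1"
  shows "card {y \<in> F (4 * t). y ^ c = z} = c"
proof -
  obtain g :: 'a where g: "g \<noteq> 0" "\<And>i. g ^ i = 1 \<longleftrightarrow> (p ^ (4 * t) - 1) dvd i"
    using exists_root_of_unity_of_order[OF dvd_minus_1[OF t_dvd]] by metis
  have gU: "g \<in> U (4 * t)" using units_eq[of "4 * t"] t_pos g(2) by auto
  \<comment> \<open>Either square root of -1 may occur here; in both cases its powers exhaust the
    fourth roots of unity.\<close>
  define u where "u = g ^ c"
  have "g ^ (2 * c) \<noteq> 1" using g(2)[of "2 * c"] c_pos unfolding four_c[symmetric] by (auto dest: dvd_imp_le)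
  then have "u * u \<noteq> 1" by (simp add: u_def mult_2 power_add)
  then have uc: "u = \<iota> \<or> u = - \<iota>"
    using fourth_root_cases[OF units_power_c[OF gU]] unfolding u_def[symmetric] by (elim disjE) simp_all
  then have uu: "u * u = -1" using iota_sq by (elim disjE) simp_all
  have pow: "(g ^ j) ^ c = u ^ j" for j unfolding u_def by (simp add: mult.commute flip: power_mult)
  have pows: "u ^ 0 = 1" "u ^ 1 = u" "u ^ 2 = -1" "u ^ 3 = - u"
    using uu by (simp_all add: power2_eq_square power3_eq_cube)
  have "z = 1 \<or> z = u \<or> z = -1 \<or> z = - u"
    using fourth_root_cases[OF assms] uc by (elim disjE) simp_all
  then have "\<exists>j. (g ^ j) ^ c = z"
    unfolding pow using pows by (elim disjE) blast+
  then obtain j where j: "(g ^ j) ^ c = z" by blast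
  have yU: "g ^ j \<in> U (4 * t)" using gU by auto
  have "{y \<in> F (4 * t). y ^ c = z} = {x. x ^ c = (g ^ j) ^ c}"
    using coset_in_units[OF yU] j by auto
  also have "card \<dots> = card {x::'a. x ^ c = 1}"
    using g(1) by (subst coset_eq) (auto intro!: card_image inj_onI)
  finally show ?thesis using card_roots_of_unity[OF c_dvd] by simp
qed

text \<open>Since \<open>\<beta>\<close> has order \<open>c\<close>, the elements
  \<open>y * \<beta> ^ j\<close> run once through the coset of \<open>y\<close>.\<close>

lemma card_trace_nonzero:
  assumes y: "y \<in> U (4 * t)" and ord: "\<And>i. \<beta> ^ i = 1 \<longleftrightarrow> c dvd i"
  shows "card {j\<in>{..<c}. abs_trace p (4 * t) (y * \<beta> ^ j) \<noteq> 0}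
    = c - card {x \<in> U (4 * t). x ^ c = y ^ c \<and> abs_trace p (4 * t) x = 0}"
proof -
  have b1: "(\<beta> ^ j) ^ c = 1" for j using ord[of "j * c"] by (simp add: power_mult)
  have b0: "\<beta> \<noteq> 0" using b1[of 1] c_pos by (auto simp: power_0_left)
  have inj: "inj_on (\<lambda>j. y * \<beta> ^ j) {..<c}"
  proof (rule linorder_inj_onI)
    fix i j assume ij: "i < j" "i \<in> {..<c}" "j \<in> {..<c}"
    show "y * \<beta> ^ i \<noteq> y * \<beta> ^ j"
    proof
      assume "y * \<beta> ^ i = y * \<beta> ^ j"
      then have "\<beta> ^ i = \<beta> ^ j" using y by simp
      also have "\<beta> ^ j = \<beta> ^ i * \<beta> ^ (j - i)" using ij by (simp flip: power_add)
      finally have "\<beta> ^ (j - i) = 1" using b0 by simp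
      then have "c dvd j - i" using ord by simp
      then show False using ij by (auto dest!: dvd_imp_le)
    qed
  qed auto
  have im: "(\<lambda>j. y * \<beta> ^ j) ` {..<c} = {x. x ^ c = y ^ c}"
  proof (rule card_subset_eq)
    show "(\<lambda>j. y * \<beta> ^ j) ` {..<c} \<subseteq> {x. x ^ c = y ^ c}" by (auto simp: power_mult_distrib b1)
    have "card {x. x ^ c = y ^ c} = c"
    proof -
      have y0: "y \<noteq> 0" using y by simp
      then have "inj_on ((*) y) {x. x ^ c = 1}" by (simp add: inj_on_def)
      then show ?thesis unfolding coset_eq[OF y0] by (subst card_image) (simp_all add: card_roots_of_unity[OF c_dvd])
    qed
    then show "card ((\<lambda>j. y * \<beta> ^ j) ` {..<c}) = card {x. x ^ c = y ^ c}"
      using card_image[OF inj] by simp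
  qed simp
  have "{j\<in>{..<c}. abs_trace p (4 * t) (y * \<beta> ^ j) \<noteq> 0}
      = {..<c} - {j\<in>{..<c}. abs_trace p (4 * t) (y * \<beta> ^ j) = 0}" by auto
  also have "card \<dots> = c - card {j\<in>{..<c}. abs_trace p (4 * t) (y * \<beta> ^ j) = 0}"
    by (subst card_Diff_subset) auto
  finally have "card {j\<in>{..<c}. abs_trace p (4 * t) (y * \<beta> ^ j) \<noteq> 0}
      = c - card {j\<in>{..<c}. abs_trace p (4 * t) (y * \<beta> ^ j) = 0}" .
  moreover have "card {j\<in>{..<c}. abs_trace p (4 * t) (y * \<beta> ^ j) = 0}
      = card {x \<in> U (4 * t). x ^ c = y ^ c \<and> abs_trace p (4 * t) x = 0}"
  proof (rule bij_betw_same_card[of "\<lambda>j. y * \<beta> ^ j"])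
    have "(\<lambda>j. y * \<beta> ^ j) ` {j\<in>{..<c}. abs_trace p (4 * t) (y * \<beta> ^ j) = 0}
        = {x \<in> (\<lambda>j. y * \<beta> ^ j) ` {..<c}. abs_trace p (4 * t) x = 0}" by auto
    also have "\<dots> = {x \<in> U (4 * t). x ^ c = y ^ c \<and> abs_trace p (4 * t) x = 0}"
      unfolding im using coset_in_units[OF y] by blast
    finally show "bij_betw (\<lambda>j. y * \<beta> ^ j) {j\<in>{..<c}. abs_trace p (4 * t) (y * \<beta> ^ j) = 0}
        {x \<in> U (4 * t). x ^ c = y ^ c \<and> abs_trace p (4 * t) x = 0}"
      using inj_on_subset[OF inj, of "{j\<in>{..<c}. abs_trace p (4 * t) (y * \<beta> ^ j) = 0}"]
      unfolding bij_betw_def by blast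
  qed
  ultimately show ?thesis by simp
qed

text \<open>\<open>\<kappa>\<close> is the real part of \<open>cnj (\<chi> y) * S\<close>; with
  \<open>\<sigma>\<close> it turns the complex count of trace-zero elements into a real one. The
  weight is \<open>c\<close> minus that count, and the constant -1 in
  \<open>4 * c = p ^ (4 * t) - 1\<close> cancels the one from excluding zero.\<close>

lemma coset_weight:
  assumes y: "y \<in> U (4 * t)" and ord: "\<And>i. \<beta> ^ i = 1 \<longleftrightarrow> c dvd i"
    and \<sigma>: "(\<chi> y)\<^sup>2 = of_real \<sigma>" and \<kappa>: "cnj (\<chi> y) * S + \<chi> y * cnj S = of_real (2 * \<kappa>)"
  shows "real (card {j\<in>{..<c}. abs_trace p (4 * t) (y * \<beta> ^ j) \<noteq> 0})
    = (real p - 1) / (4 * real p) *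
      (real p ^ (4 * t) + \<sigma> * real p ^ (2 * t) + 2 * \<kappa> * real p ^ t)"
proof -
  define Z where "Z = card {x \<in> U (4 * t). x ^ c = y ^ c \<and> abs_trace p (4 * t) x = 0}"
  have "complex_of_real (4 * real Z) = complex_of_real (real p ^ (4 * t - 1) - 1
      - \<sigma> * (real p ^ (2 * t) - real p ^ (2 * t - 1)) - (real p ^ t - real p ^ (t - 1)) * (2 * \<kappa>))"
    using card_coset_trace_0[OF y] unfolding \<sigma> \<kappa> Z_def[symmetric] by simp
  then have Z4: "4 * real Z = real p ^ (4 * t - 1) - 1
      - \<sigma> * (real p ^ (2 * t) - real p ^ (2 * t - 1)) - (real p ^ t - real p ^ (t - 1)) * (2 * \<kappa>)"
    by (simp only: of_real_eq_iff)
  \<comment> \<open>This ensures that the subtraction \<open>c - Z\<close> of natural numbers is not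
    truncated.\<close>
  have "Z \<le> card {x \<in> F (4 * t). x ^ c = y ^ c}"
    unfolding Z_def by (rule card_mono) auto
  then have Zc: "Z \<le> c" using card_quartic_class[OF units_power_c[OF y]] by simp
  have c4: "4 * real c = real p ^ (4 * t) - 1"
  proof -
    have "real (4 * c) = real (p ^ (4 * t) - 1)" by (simp only: four_c)
    then show ?thesis using p_gt_1 by (simp add: of_nat_diff)
  qed
  have pw: "real p ^ (k - 1) = real p ^ k / real p" if "k > 0" for k
    using that p_gt_1 by (cases k) auto
  have pws: "real p ^ (4 * t - 1) = real p ^ (4 * t) / real p"
    "real p ^ (2 * t - 1) = real p ^ (2 * t) / real p" "real p ^ (t - 1) = real p ^ t / real p"
    by (rule pw, use t_pos in simp)+
  have fac: "X - X / real p = (real p - 1) / real p * X" for X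
    using p_gt_1 by (simp add: field_simps)
  have "4 * (real c - real Z) = (real p ^ (4 * t) - real p ^ (4 * t) / real p)
      + \<sigma> * (real p ^ (2 * t) - real p ^ (2 * t) / real p) + 2 * \<kappa> * (real p ^ t - real p ^ t / real p)"
    unfolding right_diff_distrib c4 Z4 pws by (simp only: algebra_simps)
  then have W4: "4 * (real c - real Z) = (real p - 1) / real p *
      (real p ^ (4 * t) + \<sigma> * real p ^ (2 * t) + 2 * \<kappa> * real p ^ t)"
    unfolding fac by (simp only: distrib_left mult.left_commute)
  have "card {j\<in>{..<c}. abs_trace p (4 * t) (y * \<beta> ^ j) \<noteq> 0} = c - Z"
    unfolding Z_def by (rule card_trace_nonzero[OF y ord])
  then have "real (card {j\<in>{..<c}. abs_trace p (4 * t) (y * \<beta> ^ j) \<noteq> 0}) = (4 * (real c - real Z)) / 4"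
    using Zc by (simp add: of_nat_diff)
  then show ?thesis unfolding W4 by simp
qed

end

section \<open>Reduction of the code to coordinates\<close>

locale cyclic_code = quartic_field p M \<omega> t \<iota>
  for p M and \<omega> :: "'a::{field,finite}" and t \<iota> +
  fixes r :: nat
  assumes prime_r: "prime r" and p_neq_r: "p \<noteq> r" and coprime_4_r: "coprime 4 r"
    and q_cong_1: "[p ^ (4 * t) = 1] (mod r)" and M_eq: "M = 4 * t * r"
begin

definition q :: nat where "q = p ^ (4 * t)"
definition k :: nat where "k = 4 * Psi r q div r"
text \<open>The orders are \<open>r * c\<close> for \<open>\<alpha>\<close>, \<open>c\<close> for
  \<open>\<beta>\<close> and \<open>r\<close> for \<open>\<zeta>\<close>. As
  \<open>4 * c = q - 1\<close>, \<open>\<zeta>\<close> is the factor by which raising to the power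
  \<open>q\<close> changes \<open>\<alpha>\<close>.\<close>

definition \<alpha> :: 'a where "\<alpha> = \<omega> ^ k"
definition \<beta> :: 'a where "\<beta> = \<alpha> ^ r"
definition \<zeta> :: 'a where "\<zeta> = \<alpha> ^ (4 * c)"

text \<open>The relative trace from the whole field to \<open>F (4 * t)\<close>, the field of order
  \<open>q\<close>.\<close>

definition tr :: "'a \<Rightarrow> 'a" where "tr x = (\<Sum>j<r. x ^ (q ^ j))"

definition coord :: "'a \<Rightarrow> nat \<Rightarrow> 'a" where "coord \<gamma> s = tr (\<gamma> * \<alpha> ^ s)"

text \<open>The weight of the word of \<open>y\<close> in the code \<open>C(4, q)\<close>, up to the
  order of its coordinates.\<close>

definition W :: "'a \<Rightarrow> nat" where
  "W y = card {j\<in>{..<c}. abs_trace p (4 * t) (y * \<beta> ^ j) \<noteq> 0}"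

lemma q_eq: "q = 4 * c + 1"
  unfolding q_def four_c using p_gt_1 by simp

lemma r_pos: "r > 0"
  using prime_r by (rule prime_gt_0_nat)

lemma card_eq_q_pow: "p ^ M = q ^ r"
  unfolding q_def M_eq by (rule power_mult)

text \<open>By \<open>dvd_Psi\<close> the quotient \<open>k\<close> is exact, and the geometric
  series gives the factorization; in particular the code has length \<open>r * c\<close>.\<close>

lemma card_minus_1: "p ^ M - 1 = k * (r * c)" and k_pos: "k > 0"
proof -
  obtain m where m: "Psi r q = r * m" using dvd_Psi[OF q_cong_1] unfolding q_def by blast
  have k: "k = 4 * m" unfolding k_def m using r_pos by (simp add: mult.left_commute)
  have "Psi r q * (4 * c) + 1 = q ^ r" using Psi_geometric[of q r] unfolding q_eq by simp
  then have "p ^ M - 1 = Psi r q * (4 * c)" unfolding card_eq_q_pow by (metis add_diff_cancel_right')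
  also have "\<dots> = k * (r * c)" unfolding m k by (simp only: mult_ac)
  finally show N: "p ^ M - 1 = k * (r * c)" .
  then show "k > 0" using card_field_gt_2 by (cases "k = 0") auto
qed

lemma \<alpha>_power_eq_1_iff: "\<alpha> ^ i = 1 \<longleftrightarrow> r * c dvd i"
  unfolding \<alpha>_def power_mult[symmetric] primitive_power_eq_1_iff card_minus_1
  by (rule dvd_times_left_cancel_iff) (use k_pos in simp)

lemma \<alpha>_nz: "\<alpha> \<noteq> 0"
  using primitive_nz by (simp add: \<alpha>_def)

lemma \<beta>_power_eq_1_iff: "\<beta> ^ i = 1 \<longleftrightarrow> c dvd i"
  unfolding \<beta>_def power_mult[symmetric] \<alpha>_power_eq_1_iff
  by (rule dvd_times_left_cancel_iff) (use r_pos in simp)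

text \<open>After \<open>c\<close> is cancelled from the exponents, the factor 4 drops out because
  it is coprime to \<open>r\<close>.\<close>

lemma \<zeta>_power_eq_1_iff: "\<zeta> ^ i = 1 \<longleftrightarrow> r dvd i"
proof -
  have "\<zeta> ^ i = 1 \<longleftrightarrow> r * c dvd 4 * c * i"
    unfolding \<zeta>_def power_mult[symmetric] by (rule \<alpha>_power_eq_1_iff)
  also have "4 * c * i = 4 * i * c" by (simp only: mult_ac)
  also have "r * c dvd 4 * i * c \<longleftrightarrow> r dvd 4 * i"
    by (rule dvd_times_right_cancel_iff) (use c_pos in simp)
  also have "\<dots> \<longleftrightarrow> r dvd i"
    using coprime_4_r by (simp add: coprime_commute coprime_dvd_mult_right_iff)
  finally show ?thesis .
qed

lemma \<beta>_in: "\<beta> \<in> F (4 * t)"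
proof -
  have "\<beta> ^ (p ^ (4 * t) - 1) = 1" unfolding four_c[symmetric] \<beta>_power_eq_1_iff by simp
  then show ?thesis using units_eq[of "4 * t"] t_pos by auto
qed

text \<open>\<open>r\<close> divides \<open>q - 1\<close>, so \<open>\<zeta>\<close> is fixed by the
  \<open>q\<close>-th power, and each further application contributes one more factor
  \<open>\<zeta>\<close>.\<close>

lemma \<alpha>_frob: "\<alpha> ^ (q ^ j) = \<alpha> * \<zeta> ^ j"
proof (induction j)
  case (Suc j)
  have z: "\<zeta> ^ q = \<zeta>"
  proof -
    have "r dvd 4 * c" using q_cong_1 p_gt_1 unfolding four_c by (simp add: cong_altdef_nat)
    then have "\<zeta> ^ (4 * c) = 1" using \<zeta>_power_eq_1_iff by simp
    then show ?thesis unfolding q_eq by simp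
  qed
  have "\<alpha> ^ (q ^ Suc j) = (\<alpha> ^ (q ^ j)) ^ q" unfolding power_Suc2 power_mult ..
  also have "\<dots> = \<alpha> ^ q * (\<zeta> ^ q) ^ j"
    unfolding Suc power_mult_distrib by (simp add: mult.commute flip: power_mult)
  also have "\<alpha> ^ q = \<alpha> * \<zeta>" unfolding q_eq \<zeta>_def by simp
  finally show ?case unfolding z by (simp add: mult_ac)
qed simp

section \<open>Coordinates of a codeword over the field of order \<open>q\<close>\<close>

lemma F_4t_iff: "x \<in> F (4 * t) \<longleftrightarrow> x ^ q = x"
  by (simp add: F_def q_def)

lemma tr_in: "tr x \<in> F (4 * t)"
proof -
  have full: "x ^ (q ^ r) = x"
  proof (cases "x = 0")
    case True
    then show ?thesis using r_pos q_eq by (simp add: power_0_left)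
  next
    case False
    have "x ^ (q ^ r) = x * x ^ (p ^ M - 1)"
      unfolding card_eq_q_pow using power_Suc[of x "q ^ r - 1"] q_eq by simp
    then show ?thesis using power_card_minus_1[OF False] by simp
  qed
  have "tr x ^ q = (\<Sum>j<r. (x ^ (q ^ j)) ^ q)" unfolding tr_def q_def by (rule frob_sum)
  also have "\<dots> = (\<Sum>j<r. x ^ (q ^ Suc j))" by (simp only: power_Suc2 power_mult)
  also have "\<dots> = (\<Sum>j<Suc r. x ^ (q ^ j)) - x" by (subst sum.lessThan_Suc_shift) simp
  also have "\<dots> = tr x" using full by (simp add: tr_def)
  finally show ?thesis unfolding F_4t_iff .
qed

lemma tr_scale: "b \<in> F (4 * t) \<Longrightarrow> tr (b * x) = b * tr x"
proof -
  assume b: "b \<in> F (4 * t)"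
  have "b ^ (q ^ j) = b" for j
  proof (induction j)
    case (Suc j)
    have "b ^ (q ^ Suc j) = (b ^ (q ^ j)) ^ q" unfolding power_Suc2 power_mult ..
    then show ?case using Suc b by (simp add: F_4t_iff)
  qed simp
  then show ?thesis by (simp add: tr_def power_mult_distrib sum_distrib_left)
qed

lemma abs_trace_eq: "abs_trace p (4 * t * r) x = abs_trace p (4 * t) (tr x)"
  unfolding abs_trace_tower tr_def q_def ..

text \<open>Conjugation multiplies \<open>\<alpha>\<close> by powers of the \<open>r\<close>-th root of unity \<open>\<zeta>\<close>, so the coordinates
  are a twisted discrete Fourier transform of the conjugates of \<open>\<gamma>\<close>.\<close>
lemma fourier_inversion: "(\<Sum>s<r. inverse (\<alpha> ^ s) * coord \<gamma> s) = of_nat r * \<gamma>"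
proof -
  have "inverse (\<alpha> ^ s) * coord \<gamma> s = (\<Sum>j<r. \<gamma> ^ (q ^ j) * (\<zeta> ^ j) ^ s)" for s
  proof -
    have "(\<gamma> * \<alpha> ^ s) ^ (q ^ j) = \<alpha> ^ s * (\<gamma> ^ (q ^ j) * (\<zeta> ^ j) ^ s)" for j
    proof -
      have "(\<alpha> ^ s) ^ (q ^ j) = (\<alpha> ^ (q ^ j)) ^ s" by (simp add: mult.commute flip: power_mult)
      then show ?thesis unfolding power_mult_distrib \<alpha>_frob by (simp add: mult_ac power_mult_distrib)
    qed
    then have "coord \<gamma> s = \<alpha> ^ s * (\<Sum>j<r. \<gamma> ^ (q ^ j) * (\<zeta> ^ j) ^ s)"
      unfolding coord_def tr_def sum_distrib_left by simp
    then show ?thesis using \<alpha>_nz by simp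
  qed
  then have "(\<Sum>s<r. inverse (\<alpha> ^ s) * coord \<gamma> s) = (\<Sum>s<r. \<Sum>j<r. \<gamma> ^ (q ^ j) * (\<zeta> ^ j) ^ s)"
    by simp
  also have "\<dots> = (\<Sum>j<r. \<Sum>s<r. \<gamma> ^ (q ^ j) * (\<zeta> ^ j) ^ s)" by (rule sum.swap)
  also have "\<dots> = (\<Sum>j<r. if j = 0 then of_nat r * \<gamma> else 0)"
  proof (rule sum.cong[OF refl])
    fix j assume j: "j \<in> {..<r}"
    show "(\<Sum>s<r. \<gamma> ^ (q ^ j) * (\<zeta> ^ j) ^ s) = (if j = 0 then of_nat r * \<gamma> else 0)"
    proof (cases "j = 0")
      case False
      then have "\<zeta> ^ j \<noteq> 1" using j \<zeta>_power_eq_1_iff by (auto dest: dvd_imp_le)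
      moreover have "(\<zeta> ^ j) ^ r = 1" unfolding power_mult[symmetric] \<zeta>_power_eq_1_iff by simp
      moreover have "(\<zeta> ^ j - 1) * (\<Sum>s<r. (\<zeta> ^ j) ^ s) = (\<zeta> ^ j) ^ r - 1"
        by (rule power_diff_1_eq[symmetric])
      ultimately have "(\<Sum>s<r. (\<zeta> ^ j) ^ s) = 0" by simp
      then show ?thesis using False by (simp flip: sum_distrib_left)
    qed simp
  qed
  also have "\<dots> = of_nat r * \<gamma>" using r_pos by simp
  finally show ?thesis .
qed

text \<open>Fourier inversion recovers \<open>\<gamma>\<close> because \<open>r\<close> is nonzero
  in characteristic \<open>p\<close>; surjectivity follows since both sides have
  \<open>q ^ r\<close> elements.\<close>

lemma bij_coords:
  "bij_betw (\<lambda>\<gamma>. map (coord \<gamma>) [0..<r]) UNIV {xs. set xs \<subseteq> F (4 * t) \<and> length xs = r}"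
proof -
  let ?f = "\<lambda>\<gamma>. map (coord \<gamma>) [0..<r]"
  have "of_nat r \<noteq> (0::'a)"
    using of_nat_eq_0 prime_p prime_r p_neq_r primes_dvd_imp_eq by blast
  then have inj: "inj ?f"
  proof (intro injI)
    fix x y assume r0: "of_nat r \<noteq> (0::'a)" and "?f x = ?f y"
    then have "coord x s = coord y s" if "s < r" for s using that by simp
    then have "of_nat r * x = of_nat r * y" by (simp flip: fourier_inversion)
    then show "x = y" using r0 by simp
  qed
  have "?f ` UNIV = {xs. set xs \<subseteq> F (4 * t) \<and> length xs = r}"
  proof (rule card_subset_eq)
    show "finite {xs. set xs \<subseteq> F (4 * t) \<and> length xs = r}" by (rule finite_lists_length_eq) simp
    show "?f ` UNIV \<subseteq> {xs. set xs \<subseteq> F (4 * t) \<and> length xs = r}"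
      using tr_in by (auto simp: coord_def)
    show "card (?f ` UNIV) = card {xs. set xs \<subseteq> F (4 * t) \<and> length xs = r}"
      unfolding card_image[OF inj] card_field card_eq_q_pow using t_pos t_dvd
      by (subst card_lists_length_eq) (simp_all add: card_F q_def)
  qed
  then show ?thesis using inj by (simp add: bij_betw_def)
qed

text \<open>At the index \<open>s + j * r\<close> the power of \<open>\<alpha>\<close> is
  \<open>\<alpha> ^ s * \<beta> ^ j\<close>. The factor \<open>\<beta> ^ j\<close> lies in
  \<open>F (4 * t)\<close> and passes through \<open>tr\<close>, so for fixed \<open>s\<close> the
  count over \<open>j\<close> is a weight \<open>W\<close>.\<close>

lemma cw_weight_eq: "cw_weight p (4 * t * r) \<omega> k \<gamma> = sum_list (map W (map (coord \<gamma>) [0..<r]))"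
proof -
  let ?g = "\<lambda>i. if abs_trace p (4 * t * r) (\<gamma> * \<omega> ^ (k * i)) \<noteq> 0 then 1 else 0 :: nat"
  have len: "(CARD('a) - 1) div k = c * r"
    unfolding card_field card_minus_1 using k_pos by (simp add: mult.commute)
  have "cw_weight p (4 * t * r) \<omega> k \<gamma> = (\<Sum>i<c * r. ?g i)"
    unfolding cw_weight_def len by (simp add: sum.inter_filter[symmetric] atLeast0LessThan)
  also have "\<dots> = (\<Sum>j<c. \<Sum>i\<in>{j * r..<j * r + r}. ?g i)" by (rule sum.nat_group[symmetric])
  also have "\<dots> = (\<Sum>j<c. \<Sum>s<r. if abs_trace p (4 * t) (coord \<gamma> s * \<beta> ^ j) \<noteq> 0 then 1 else 0)"
  proof (rule sum.cong[OF refl])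
    fix j
    have "(\<Sum>i\<in>{j * r..<j * r + r}. ?g i) = (\<Sum>s<r. ?g (s + j * r))"
      using sum.shift_bounds_nat_ivl[of ?g 0 "j * r" r] by (simp add: add.commute atLeast0LessThan)
    also have "\<dots> = (\<Sum>s<r. if abs_trace p (4 * t) (coord \<gamma> s * \<beta> ^ j) \<noteq> 0 then 1 else 0)"
    proof (rule sum.cong[OF refl])
      fix s
      have "\<omega> ^ (k * (s + j * r)) = \<alpha> ^ s * \<beta> ^ j"
        unfolding \<beta>_def \<alpha>_def by (simp add: algebra_simps flip: power_mult power_add)
      then have eq: "\<gamma> * \<omega> ^ (k * (s + j * r)) = \<beta> ^ j * (\<gamma> * \<alpha> ^ s)" by (simp only: mult_ac)
      have "\<beta> ^ j \<in> F (4 * t)" using \<beta>_in by simp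
      then have "tr (\<gamma> * \<omega> ^ (k * (s + j * r))) = coord \<gamma> s * \<beta> ^ j"
        unfolding eq coord_def by (simp only: tr_scale mult.commute)
      then show "?g (s + j * r) = (if abs_trace p (4 * t) (coord \<gamma> s * \<beta> ^ j) \<noteq> 0 then 1 else 0)"
        unfolding abs_trace_eq by simp
    qed
    finally show "(\<Sum>i\<in>{j * r..<j * r + r}. ?g i)
      = (\<Sum>s<r. if abs_trace p (4 * t) (coord \<gamma> s * \<beta> ^ j) \<noteq> 0 then 1 else 0)" .
  qed
  also have "\<dots> = (\<Sum>s<r. \<Sum>j<c. if abs_trace p (4 * t) (coord \<gamma> s * \<beta> ^ j) \<noteq> 0 then 1 else 0)"
    by (rule sum.swap)
  also have "\<dots> = (\<Sum>s<r. W (coord \<gamma> s))"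
    by (rule sum.cong[OF refl]) (simp add: W_def sum.inter_filter[symmetric])
  finally show ?thesis by (simp add: comp_def interv_sum_list_conv_sum_set_nat atLeast0LessThan)
qed

lemma frequency_eq:
  "frequency p (4 * t * r) \<omega> k w = card {xs. set xs \<subseteq> F (4 * t) \<and> length xs = r \<and> sum_list (map W xs) = w}"
proof -
  let ?f = "\<lambda>\<gamma>. map (coord \<gamma>) [0..<r]"
  have "?f ` {\<gamma>. sum_list (map W (?f \<gamma>)) = w}
      = {xs \<in> ?f ` UNIV. sum_list (map W xs) = w}" by blast
  also have "\<dots> = {xs. set xs \<subseteq> F (4 * t) \<and> length xs = r \<and> sum_list (map W xs) = w}"
    using bij_coords unfolding bij_betw_def by auto
  finally have "card {xs. set xs \<subseteq> F (4 * t) \<and> length xs = r \<and> sum_list (map W xs) = w}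
      = card (?f ` {\<gamma>. sum_list (map W (?f \<gamma>)) = w})" by simp
  also have "\<dots> = card {\<gamma>. sum_list (map W (?f \<gamma>)) = w}"
    by (rule card_image) (use bij_coords in \<open>auto simp: bij_betw_def intro: inj_on_subset\<close>)
  finally show ?thesis unfolding frequency_def cw_weight_eq by simp
qed

section \<open>Weights of single coordinates and the resulting frequencies\<close>

lemma W_0: "W 0 = 0"
  by (simp add: W_def)

text \<open>The real part of \<open>cnj (\<theta> z) * S\<close> is \<open>A\<close>,
  \<open>B\<close>, \<open>- A\<close>, \<open>- B\<close> for \<open>z\<close> equal to
  \<open>1\<close>, \<open>\<iota>\<close>, \<open>-1\<close>, \<open>- \<iota>\<close>, and
  \<open>\<theta> z\<close> squares to 1 for the real values and to -1 for the others.\<close>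

lemma W_unit:
  assumes "y \<in> U (4 * t)" "y ^ c = z"
  shows "real (W y) = (real p - 1) / (4 * real p) * (real p ^ (4 * t) +
    (if z = 1 then real p ^ (2 * t) + 2 * of_int A * real p ^ t
     else if z = -1 then real p ^ (2 * t) - 2 * of_int A * real p ^ t
     else if z = \<iota> then - (real p ^ (2 * t)) + 2 * of_int B * real p ^ t
     else - (real p ^ (2 * t)) - 2 * of_int B * real p ^ t))"
proof -
  have main: "real (W y) = (real p - 1) / (4 * real p) *
      (real p ^ (4 * t) + \<sigma> * real p ^ (2 * t) + 2 * \<kappa> * real p ^ t)"
    if "(\<theta> z)\<^sup>2 = of_real \<sigma>" "cnj (\<theta> z) * S + \<theta> z * cnj S = of_real (2 * \<kappa>)" for \<sigma> \<kappa>
    unfolding W_def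
    by (rule coset_weight[OF assms(1) \<beta>_power_eq_1_iff]) (use that assms(2) in \<open>auto simp: \<chi>_def\<close>)
  have "z = 1 \<or> z = \<iota> \<or> z = -1 \<or> z = -\<iota>"
    using fourth_root_cases[OF units_power_c[OF assms(1)]] assms(2) by simp
  then consider "z = 1" | "z = \<iota>" | "z = -1" | "z = -\<iota>" by blast
  then show ?thesis
  proof cases
    case 1
    then show ?thesis
      using main[of 1 "of_int A"] by (simp add: fourth_root_values S_eq)
  next
    case 2
    then show ?thesis
      using main[of "-1" "of_int B"] quartic_distinct
      by (simp add: fourth_root_values S_eq algebra_simps)
  next
    case 3
    then show ?thesis
      using main[of 1 "- of_int A"] quartic_distinct by (simp add: fourth_root_values S_eq)
  next
    case 4
    then show ?thesis
      using main[of "-1" "- of_int B"] quartic_distinct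
      by (simp add: fourth_root_values S_eq algebra_simps)
  qed
qed

text \<open>Only the absolute values of \<open>A\<close> and \<open>B\<close> are known, but a
  change of sign merely exchanges two classes of equal size. The classes are therefore numbered to
  suit \<open>a\<close> and \<open>b\<close>.\<close>

lemma frequency_formula:
  fixes a b :: int
  assumes a: "\<bar>A\<bar> = \<bar>a\<bar>" and b: "\<bar>B\<bar> = \<bar>2 * b\<bar>"
  shows "frequency p (4 * t * r) \<omega> k w =
     (\<Sum>(l1, l2, l3, l4) \<in> {(l1, l2, l3, l4).
          l1 + l2 + l3 + l4 \<le> r \<and>
          real w = (real p - 1) / (4 * real p) *
            (real (l1 + l2 + l3 + l4) * real p ^ (4 * t)
             + (real l1 + real l2 - real l3 - real l4) * real p ^ (2 * t)
             + (2 * of_int a * (real l1 - real l2) + 4 * of_int b * (real l3 - real l4))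
               * real p ^ t)}.
        (r choose (l1 + l2 + l3 + l4)) * multinomial4 l1 l2 l3 l4 * c ^ (l1 + l2 + l3 + l4))"
proof -
  \<comment> \<open>\<open>za\<close> and \<open>zb\<close> are the fourth roots of unity whose
    classes carry the terms with \<open>2 * a\<close> and \<open>4 * b\<close>; their negatives
    carry the opposite terms.\<close>
  define za where "za = (if A = a then 1 else -1 :: 'a)"
  define zb where "zb = (if B = 2 * b then \<iota> else - \<iota>)"
  have za: "za = 1 \<and> A = a \<or> za = -1 \<and> A = - a" using a by (auto simp: za_def)
  have zb: "zb = \<iota> \<and> B = 2 * b \<or> zb = - \<iota> \<and> B = - (2 * b)" using b by (auto simp: zb_def)
  have dist: "za \<noteq> - za" "za \<noteq> zb" "za \<noteq> - zb" "- za \<noteq> zb" "- za \<noteq> - zb" "zb \<noteq> - zb"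
    "za \<noteq> 0" "zb \<noteq> 0"
    using za zb quartic_distinct iota_sq by (elim disjE conjE; simp)+
  define lab :: "'a \<Rightarrow> nat" where "lab y =
    (if y = 0 then 0 else if y ^ c = za then 1 else if y ^ c = - za then 2
     else if y ^ c = zb then 3 else 4)" for y
  have four: "za ^ 4 = 1" "(- za) ^ 4 = 1" "zb ^ 4 = 1" "(- zb) ^ 4 = 1"
    using za zb iota_sq by (elim disjE conjE; simp add: power4_eq_xxxx)+
  have cases4: "y ^ c = za \<or> y ^ c = - za \<or> y ^ c = zb \<or> y ^ c = - zb" if "y \<in> U (4 * t)" for y
    using fourth_root_cases[OF units_power_c[OF that]] za zb by (elim disjE conjE; simp)
  have classes: "{y \<in> F (4 * t). lab y = 0} = {0}"
    "{y \<in> F (4 * t). lab y = 1} = {y \<in> F (4 * t). y ^ c = za}"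
    "{y \<in> F (4 * t). lab y = 2} = {y \<in> F (4 * t). y ^ c = - za}"
    "{y \<in> F (4 * t). lab y = 3} = {y \<in> F (4 * t). y ^ c = zb}"
    "{y \<in> F (4 * t). lab y = 4} = {y \<in> F (4 * t). y ^ c = - zb}"
    using dist cases4 c_pos unfolding lab_def by (auto simp: power_0_left split: if_splits)
  have card_lab: "card {y \<in> F (4 * t). lab y = i} = c" if "i \<in> {1, 2, 3, 4}" for i
    using that unfolding insert_iff empty_iff
    by (elim disjE FalseE; simp only: classes card_quartic_class[OF four(1)] card_quartic_class[OF four(2)]
        card_quartic_class[OF four(3)] card_quartic_class[OF four(4)])
  define I where "I i y = (if lab y = i then 1 else 0 :: real)" for i y
  \<comment> \<open>With real arguments one formula accepts the indicators \<open>I i y\<close> of a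
    single coordinate and the counts of a whole list; its additivity then drives the induction over
    the list.\<close>
  define wt where "wt l1 l2 l3 l4 = (real p - 1) / (4 * real p) *
      ((l1 + l2 + l3 + l4) * real p ^ (4 * t) + (l1 + l2 - l3 - l4) * real p ^ (2 * t)
       + (2 * of_int a * (l1 - l2) + 4 * of_int b * (l3 - l4)) * real p ^ t)" for l1 l2 l3 l4 :: real
  have Wy: "real (W y) = wt (I 1 y) (I 2 y) (I 3 y) (I 4 y)" if y: "y \<in> F (4 * t)" for y
  proof (cases "y = 0")
    case True
    then show ?thesis by (simp add: W_0 wt_def I_def lab_def)
  next
    case False
    then have yU: "y \<in> U (4 * t)" using y by simp
    consider (1) "y ^ c = za" | (2) "y ^ c = - za" | (3) "y ^ c = zb" | (4) "y ^ c = - zb"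
      using cases4[OF yU] by blast
    then show ?thesis
    proof cases
      case 1
      then have "lab y = 1" using False dist by (simp add: lab_def)
      then show ?thesis unfolding W_unit[OF yU 1] I_def wt_def
        using za quartic_distinct by (elim disjE conjE) simp_all
    next
      case 2
      then have "lab y = 2" using False dist by (simp add: lab_def)
      then show ?thesis unfolding W_unit[OF yU 2] I_def wt_def
        using za quartic_distinct by (elim disjE conjE) simp_all
    next
      case 3
      then have "lab y = 3" using False dist by (simp add: lab_def)
      then show ?thesis unfolding W_unit[OF yU 3] I_def wt_def
        using zb quartic_distinct by (elim disjE conjE) simp_all
    next
      case 4
      then have "lab y = 4" using False dist by (simp add: lab_def)
      then show ?thesis unfolding W_unit[OF yU 4] I_def wt_def
        using zb quartic_distinct by (elim disjE conjE) simp_all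
    qed
  qed
  define n where "n i xs = length (filter (\<lambda>x. lab x = i) xs)" for i xs
  have weight: "real (sum_list (map W xs)) = wt (n 1 xs) (n 2 xs) (n 3 xs) (n 4 xs)"
    if "set xs \<subseteq> F (4 * t)" for xs
    using that
  proof (induction xs)
    case Nil
    then show ?case by (simp add: wt_def n_def)
  next
    case (Cons x xs)
    have nI: "real (n i (x # xs)) = I i x + real (n i xs)" for i
      by (simp add: n_def I_def)
    have "real (sum_list (map W (x # xs))) = wt (I 1 x) (I 2 x) (I 3 x) (I 4 x)
        + wt (n 1 xs) (n 2 xs) (n 3 xs) (n 4 xs)"
      using Cons Wy[of x] by simp
    also have "\<dots> = wt (I 1 x + n 1 xs) (I 2 x + n 2 xs) (I 3 x + n 3 xs) (I 4 x + n 4 xs)"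
      unfolding wt_def distrib_left[symmetric] by (rule arg_cong[of _ _ "(*) _"]) (simp add: algebra_simps)
    finally show ?case unfolding nI .
  qed
  have lab_range: "lab ` F (4 * t) \<subseteq> {0, 1, 2, 3, 4}"
    by (rule image_subsetI) (simp add: lab_def)
  have "frequency p (4 * t * r) \<omega> k w
      = card {xs. set xs \<subseteq> F (4 * t) \<and> length xs = r \<and> sum_list (map W xs) = w}"
    by (rule frequency_eq)
  also have "{xs. set xs \<subseteq> F (4 * t) \<and> length xs = r \<and> sum_list (map W xs) = w}
      = {xs. set xs \<subseteq> F (4 * t) \<and> length xs = r \<and> real w = wt (n 1 xs) (n 2 xs) (n 3 xs) (n 4 xs)}"
    using weight by (intro Collect_cong) (metis of_nat_eq_iff)
  also have "card \<dots> = (\<Sum>(l1, l2, l3, l4)\<in>{(l1, l2, l3, l4). l1 + l2 + l3 + l4 \<le> r \<and>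
        real w = wt (real l1) (real l2) (real l3) (real l4)}.
        (r choose (l1 + l2 + l3 + l4)) * multinomial4 l1 l2 l3 l4 * c ^ (l1 + l2 + l3 + l4))"
    unfolding n_def
    by (rule card_lists_four_classes[OF _ lab_range, where Q = "\<lambda>l1 l2 l3 l4. real w = wt (real l1) (real l2) (real l3) (real l4)"])
      (use classes(1) card_lab in simp_all)
  finally show ?thesis unfolding wt_def by (simp only: of_nat_add)
qed

end

theorem theorem5p3:
  fixes p r t :: nat and a b :: int and \<omega> :: "'a::{field,finite}"
  assumes "prime p" and "prime r" and "p \<noteq> r"
    and "p mod 4 = 1" and "gcd 4 r = 1"
    and "t \<ge> 1"
    and "[p ^ (4 * t) = 1] (mod r)"
    and "CARD('a) = (p ^ (4 * t)) ^ r"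
    and "primitive_element \<omega>"
    and "(p:: int) ^ (2 * t) = a ^ 2 + 4 * b ^ 2"
    and "[a = 1] (mod 4)" and "gcd a (int p) = 1"
  shows "\<forall>w::nat.
     frequency p (4 * t * r) \<omega> (4 * Psi r (p ^ (4 * t)) div r) w =
     (\<Sum>(l1, l2, l3, l4) \<in> {(l1, l2, l3, l4).
          l1 + l2 + l3 + l4 \<le> r \<and>
          real w = (real p - 1) / (4 * real p) *
            (real (l1 + l2 + l3 + l4) * real p ^ (4 * t)
             + (real l1 + real l2 - real l3 - real l4) * real p ^ (2 * t)
             + (2 * of_int a * (real l1 - real l2) + 4 * of_int b * (real l3 - real l4))
               * real p ^ t)}.
        (r choose (l1 + l2 + l3 + l4)) * multinomial4 l1 l2 l3 l4
          * ((p ^ (4 * t) - 1) div 4) ^ (l1 + l2 + l3 + l4))"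
proof -
  interpret PF: primitive_field p "4 * t * r" \<omega>
    using assms by unfold_locales (simp_all add: power_mult)
  have "4 dvd p ^ (4 * t * r) - 1" using PF.p_pow_mod_4[of "4 * t * r"] by presburger
  \<comment> \<open>An element of order 4 squares to -1 and serves as
    \<open>\<iota>\<close>.\<close>
  then obtain g :: 'a where g: "\<And>i. g ^ i = 1 \<longleftrightarrow> 4 dvd i"
    using PF.exists_root_of_unity_of_order by metis
  have "(g * g) * (g * g) = 1" "g * g \<noteq> 1"
    using g[of 4] g[of 2] by (simp_all add: power4_eq_xxxx power2_eq_square mult.assoc)
  then have "g * g = -1" by (simp add: square_eq_1_iff)
  then interpret CC: cyclic_code p "4 * t * r" \<omega> t g r
    using assms by unfold_locales (auto simp: coprime_iff_gcd_eq_1)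
  have odd_a: "odd a" using assms(11) unfolding cong_def by presburger
  have "\<not> int p dvd a"
  proof
    assume "int p dvd a"
    then have "int p dvd gcd a (int p)" by simp
    then show False using assms(12) PF.p_gt_1 by simp
  qed
  \<comment> \<open>Both \<open>a, 2 * b\<close> and \<open>A, B\<close> represent
    \<open>p ^ (2 * t)\<close> as a sum of two squares with first entry odd and prime to
    \<open>p\<close>, so they agree up to signs.\<close>
  then have "\<bar>CC.A\<bar> = \<bar>a\<bar>" "\<bar>CC.B\<bar> = \<bar>2 * b\<bar>"
    using sum_two_squares_prime_power_unique[of p a "2 * b" "2 * t" CC.A CC.B]
      assms(1,10) PF.odd_p_pow[of 1] CC.A_B_norm CC.not_p_dvd_A odd_a CC.odd_A CC.even_B
    by (simp_all add: power_mult_distrib)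
  then show ?thesis
    using CC.frequency_formula unfolding CC.k_def CC.q_def CC.c_def by blast
qed

end
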